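(* In the regression setting and with the notation given in the context, let $\delta_1,\delta_2$ be two regression procedures with estimators $\widehat f_{n,1},\widehat f_{n,2}$ ($n\ge 1$) of $f$, and suppose that $\widehat f_{n,1}$ converges exactly at rate $\{p_n\}$ in probability and $\widehat f_{n,2}$ converges exactly at rate $\{q_n\}$ in probability, both under the $L_2$ loss. Assume: (0) there is a constant $\overline\sigma^2>0$ such that $E(\varepsilon_i^2\mid X_i)\le\overline\sigma^2$ almost surely for all $i\ge1$; (1) there is a sequence of positive numbers $\{A_n\}$ such that $\|f-\widehat f_{n,j}\|_\infty=O_p(A_n)$ for $j=1,2$; (2) under the $L_2$ loss, either $\delta_1$ is asymptotically better than $\delta_2$, or $\delta_2$ is asymptotically better than $\delta_1$; (3) there is a sequence of positive numbers $\{M_n\}$ such that $\|f-\widehat f_{n,j}\|_4/\|f-\widehat f_{n,j}\|_2=O_p(M_n)$ for $j=1,2$; and assume moreover that $M_n=O(1)$ and $A_n=O(1)$. Then the delete-$n_2$ cross validation is consistent, i.e. $P(\widehat I_n\ne I^* )\to0$ as $n\to\infty$, in each of the following two cases for the data splitting $n=n_1+n_2$ (with $n_1=n_1(n)$, $n_2=n_2(n)$): (i) $\max(p_n,q_n)=O(n^{-1/2})$, with the choice $n_1\to\infty$ and $n_2/n_1\to\infty$; (ii) $\max(p_n,q_n)\,n^{1/2}\to\infty$, with any choice such that $n_1\to\infty$ and $n_1/n_2=O(1)$.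
   Context: Setting: $Y_i=f(X_i)+\varepsilon_i$, $i\ge 1$, where $(X_i,Y_i)$ are independent observations, the $X_i$ are i.i.d. with (unknown) distribution $P_X$ on a Borel set $\mathcal X\subset\mathbb R^d$, $d\ge1$, $f$ is the true regression function, and $E(\varepsilon_i\mid X_i)=0$, $E(\varepsilon_i^2\mid X_i)<\infty$ almost surely. The errors need not be identically distributed. A regression procedure $\delta_j$ produces, from a sample $(X_i,Y_i)_{i=1}^n$ of any size $n$, an estimator $\widehat f_{n,j}$ of $f$ (a function on $\mathcal X$). Norms: $\|g\|_q=\left(\int|g(x)|^qP_X(dx)\right)^{1/q}$ for $1\le q<\infty$, and $\|g\|_\infty=\operatorname{ess\,sup}|g|$ (with respect to $P_X$). The $L_2$ loss is $L(f,\widehat f)=\|f-\widehat f\|_2$. Asymptotically better: under a loss $L$, a procedure with estimators $\widehat\theta_{n,1}$ is asymptotically better than one with estimators $\widehat\theta_{n,2}$ if for every $0<\epsilon<1$ there is a constant $c_\epsilon>0$ such that for all large enough $n$, $P\big(L(\theta,\widehat\theta_{n,2})\ge(1+c_\epsilon)L(\theta,\widehat\theta_{n,1})\big)\ge1-\epsilon$. Exact rate: for a sequence $\{a_n\}$ of positive numbers approaching zero, $\{\widehat\theta_n\}$ converges exactly at rate $\{a_n\}$ in probability under $L$ if $L(\theta,\widehat\theta_n)=O_p(a_n)$ and for every $0<\epsilon<1$ there is $c_\epsilon>0$ such that $P(L(\theta,\widehat\theta_n)\ge c_\epsilon a_n)\ge1-\epsilon$ for all large enough $n$. Delete-$n_2$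 cross validation: with $n_2=n-n_1$, apply $\delta_1,\delta_2$ to the estimation data $(X_i,Y_i)_{i=1}^{n_1}$ to obtain $\widehat f_{n_1,1},\widehat f_{n_1,2}$, and compute $\mathrm{CV}(\widehat f_{n_1,j})=\sum_{i=n_1+1}^n(Y_i-\widehat f_{n_1,j}(X_i))^2$, $j=1,2$. Let $\widehat I_n=1$ if $\mathrm{CV}(\widehat f_{n_1,1})\le\mathrm{CV}(\widehat f_{n_1,2})$ and $\widehat I_n=2$ otherwise. Let $I^*=1$ if $\delta_1$ is asymptotically better than $\delta_2$ under the $L_2$ loss, and $I^*=2$ if $\delta_2$ is asymptotically better than $\delta_1$.
   Formalization: In case (i), max(p_n,q_n)=O(n^{-1/2}) is read as "exactly of order n^{-1/2}" (bounded above and below by multiples of n^{-1/2}); with only the upper bound the claim fails, e.g. f=0, Gaussian errors, estimators 1/n and 2/n, n_1=⌊n^{2/3}⌋. *)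

theory Defs
  imports "HOL-Probability.Probability" "HOL-Library.Landau_Symbols"
begin

section \<open>The regression model\<close>

text \<open>
  The sigma-algebra on the design space \<open>S\<close> is the trace \<open>restrict_space borel S\<close>, so that
  \<open>P\<close>, \<open>f\<close> and the estimators live on \<open>S\<close> only. Observations are indexed from 1; the values
  at index 0 are irrelevant. The independence assumption is on the pairs \<open>(X i, Y i)\<close>; the \<open>Y i\<close>
  need not be identically distributed.

  For a general measurable integrand, \<open>real_cond_exp\<close> is the difference of the conditional
  expectations of the positive and the negative part; these are almost surely finite here because
  of the assumption on the conditional second moments.
\<close>

definition sigma_gen :: "'w measure \<Rightarrow> (real ^ 'd) set \<Rightarrow> ('w \<Rightarrow> real ^ 'd) \<Rightarrow> 'w measure" where
  "sigma_gen M S Z = vimage_algebra (space M) Z (restrict_space borel S)"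

locale regression_model = prob_space M
  for M :: "'w measure" +
  fixes S :: "(real ^ 'd) set"
    and P :: "(real ^ 'd) measure"
    and f :: "real ^ 'd \<Rightarrow> real"
    and X :: "nat \<Rightarrow> 'w \<Rightarrow> real ^ 'd"
    and Y :: "nat \<Rightarrow> 'w \<Rightarrow> real"
    and err :: "nat \<Rightarrow> 'w \<Rightarrow> real"
  assumes S_borel: "S \<in> sets borel"
    and f_measurable: "f \<in> borel_measurable (restrict_space borel S)"
    and X_measurable: "\<And>i. i \<ge> 1 \<Longrightarrow> X i \<in> M \<rightarrow>\<^sub>M restrict_space borel S"
    and err_measurable: "\<And>i. i \<ge> 1 \<Longrightarrow> err i \<in> borel_measurable M"
    and model: "\<And>i \<omega>. i \<ge> 1 \<Longrightarrow> \<omega> \<in> space M \<Longrightarrow> Y i \<omega> = f (X i \<omega>) + err i \<omega>"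
    and X_distr: "\<And>i. i \<ge> 1 \<Longrightarrow> distr M (restrict_space borel S) (X i) = P"
    and indep: "indep_vars (\<lambda>_. restrict_space borel S \<Otimes>\<^sub>M borel) (\<lambda>i \<omega>. (X i \<omega>, Y i \<omega>)) {1..}"
    and err_mean: "\<And>i. i \<ge> 1 \<Longrightarrow> AE \<omega> in M. real_cond_exp M (sigma_gen M S (X i)) (err i) \<omega> = 0"
    and err_second_moment: "\<And>i. i \<ge> 1 \<Longrightarrow>
      AE \<omega> in M. nn_cond_exp M (sigma_gen M S (X i)) (\<lambda>\<omega>. ennreal ((err i \<omega>)\<^sup>2)) \<omega> < \<infinity>"

section \<open>Regression procedures\<close>

text \<open>
  A procedure maps a sample size \<open>n\<close>, a sample indexed by \<open>{1..n}\<close> and a point to the value of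
  the estimator at that point. Joint measurability in sample and point makes all losses and the
  cross validation criteria random variables.
\<close>

type_synonym 'd procedure = "nat \<Rightarrow> (nat \<Rightarrow> (real ^ 'd) \<times> real) \<Rightarrow> real ^ 'd \<Rightarrow> real"

definition regression_procedure :: "(real ^ 'd) set \<Rightarrow> 'd procedure \<Rightarrow> bool" where
  "regression_procedure S \<delta> \<longleftrightarrow>
     (\<forall>n\<ge>1. case_prod (\<delta> n) \<in> borel_measurable
        (PiM {1..n} (\<lambda>_. restrict_space borel S \<Otimes>\<^sub>M borel) \<Otimes>\<^sub>M restrict_space borel S))"

definition estimator ::
  "(nat \<Rightarrow> 'w \<Rightarrow> real ^ 'd) \<Rightarrow> (nat \<Rightarrow> 'w \<Rightarrow> real) \<Rightarrow> 'd procedure \<Rightarrow> nat \<Rightarrow> 'w \<Rightarrow> real ^ 'd \<Rightarrow> real" where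
  "estimator X Y \<delta> n \<omega> = \<delta> n (\<lambda>i\<in>{1..n}. (X i \<omega>, Y i \<omega>))"

section \<open>Norms and stochastic rates\<close>

text \<open>Norms take values in \<open>[0,\<infinity>]\<close>; the Bochner integral would give non-integrable functions norm 0.\<close>

definition Lq_norm :: "real \<Rightarrow> 'a measure \<Rightarrow> ('a \<Rightarrow> real) \<Rightarrow> ennreal" where
  "Lq_norm q P g =
     (let I = \<integral>\<^sup>+ x. ennreal (\<bar>g x\<bar> powr q) \<partial>P
      in if I = \<infinity> then \<infinity> else ennreal (enn2real I powr (1 / q)))"

definition Linf_norm :: "'a measure \<Rightarrow> ('a \<Rightarrow> real) \<Rightarrow> ennreal" where
  "Linf_norm P g = esssup P (\<lambda>x. ennreal \<bar>g x\<bar>)"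

definition bounded_in_prob :: "'w measure \<Rightarrow> (nat \<Rightarrow> 'w \<Rightarrow> ennreal) \<Rightarrow> (nat \<Rightarrow> real) \<Rightarrow> bool" where
  "bounded_in_prob M Z a \<longleftrightarrow>
     (\<forall>\<epsilon>>0. \<exists>C>0. \<forall>\<^sub>F n in sequentially.
        measure M {\<omega> \<in> space M. Z n \<omega> > ennreal (C * a n)} < \<epsilon>)"

definition converges_exactly_at_rate ::
  "'w measure \<Rightarrow> (nat \<Rightarrow> 'w \<Rightarrow> ennreal) \<Rightarrow> (nat \<Rightarrow> real) \<Rightarrow> bool" where
  "converges_exactly_at_rate M Z a \<longleftrightarrow>
     (\<forall>n\<ge>1. a n > 0) \<and> a \<longlonglongrightarrow> 0 \<and> bounded_in_prob M Z a \<and>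
     (\<forall>\<epsilon>. 0 < \<epsilon> \<and> \<epsilon> < 1 \<longrightarrow> (\<exists>c>0. \<forall>\<^sub>F n in sequentially.
        measure M {\<omega> \<in> space M. Z n \<omega> \<ge> ennreal (c * a n)} \<ge> 1 - \<epsilon>))"

text \<open>The procedure with losses \<open>L1\<close> is asymptotically better than the one with losses \<open>L2\<close>.\<close>

definition asymptotically_better ::
  "'w measure \<Rightarrow> (nat \<Rightarrow> 'w \<Rightarrow> ennreal) \<Rightarrow> (nat \<Rightarrow> 'w \<Rightarrow> ennreal) \<Rightarrow> bool" where
  "asymptotically_better M L1 L2 \<longleftrightarrow>
     (\<forall>\<epsilon>. 0 < \<epsilon> \<and> \<epsilon> < 1 \<longrightarrow> (\<exists>c>0. \<forall>\<^sub>F n in sequentially.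
        measure M {\<omega> \<in> space M. L2 n \<omega> \<ge> ennreal (1 + c) * L1 n \<omega>} \<ge> 1 - \<epsilon>))"

definition Lq_loss ::
  "real \<Rightarrow> (real ^ 'd) measure \<Rightarrow> (real ^ 'd \<Rightarrow> real) \<Rightarrow> (nat \<Rightarrow> 'w \<Rightarrow> real ^ 'd) \<Rightarrow> (nat \<Rightarrow> 'w \<Rightarrow> real) \<Rightarrow>
   'd procedure \<Rightarrow> nat \<Rightarrow> 'w \<Rightarrow> ennreal" where
  "Lq_loss q P f X Y \<delta> n \<omega> = Lq_norm q P (\<lambda>x. f x - estimator X Y \<delta> n \<omega> x)"

definition Linf_loss ::
  "(real ^ 'd) measure \<Rightarrow> (real ^ 'd \<Rightarrow> real) \<Rightarrow> (nat \<Rightarrow> 'w \<Rightarrow> real ^ 'd) \<Rightarrow> (nat \<Rightarrow> 'w \<Rightarrow> real) \<Rightarrow>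
   'd procedure \<Rightarrow> nat \<Rightarrow> 'w \<Rightarrow> ennreal" where
  "Linf_loss P f X Y \<delta> n \<omega> = Linf_norm P (\<lambda>x. f x - estimator X Y \<delta> n \<omega> x)"

section \<open>Cross validation\<close>

definition CV_criterion ::
  "(nat \<Rightarrow> 'w \<Rightarrow> real ^ 'd) \<Rightarrow> (nat \<Rightarrow> 'w \<Rightarrow> real) \<Rightarrow> 'd procedure \<Rightarrow> nat \<Rightarrow> nat \<Rightarrow> 'w \<Rightarrow> real" where
  "CV_criterion X Y \<delta> m n \<omega> = (\<Sum>i\<in>{m+1..n}. (Y i \<omega> - estimator X Y \<delta> m \<omega> (X i \<omega>))\<^sup>2)"

definition CV_choice ::
  "(nat \<Rightarrow> 'w \<Rightarrow> real ^ 'd) \<Rightarrow> (nat \<Rightarrow> 'w \<Rightarrow> real) \<Rightarrow> 'd procedure \<Rightarrow> 'd procedure \<Rightarrow>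
   nat \<Rightarrow> nat \<Rightarrow> 'w \<Rightarrow> nat" where
  "CV_choice X Y \<delta>1 \<delta>2 m n \<omega> =
     (if CV_criterion X Y \<delta>1 m n \<omega> \<le> CV_criterion X Y \<delta>2 m n \<omega> then 1 else 2)"

text \<open>
  The \<open>undefined\<close> branch is excluded in the presence of an asymptotically better procedure, and
  under an exact rate of convergence the first two conditions exclude each other.
\<close>

definition better_index :: "'w measure \<Rightarrow> (nat \<Rightarrow> 'w \<Rightarrow> ennreal) \<Rightarrow> (nat \<Rightarrow> 'w \<Rightarrow> ennreal) \<Rightarrow> nat" where
  "better_index M L1 L2 =
     (if asymptotically_better M L1 L2 then 1
      else if asymptotically_better M L2 L1 then 2 else undefined)"

text \<open>Both parts are required to be nonempty, so that \<open>n1 n / n2 n\<close> is a genuine quotient.\<close>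

definition data_splitting :: "(nat \<Rightarrow> nat) \<Rightarrow> (nat \<Rightarrow> nat) \<Rightarrow> bool" where
  "data_splitting n1 n2 \<longleftrightarrow>
     (\<forall>\<^sub>F n in sequentially. n1 n > 0 \<and> n2 n > 0 \<and> n1 n + n2 n = n)"

definition CV_consistent ::
  "'w measure \<Rightarrow> (real ^ 'd) measure \<Rightarrow> (real ^ 'd \<Rightarrow> real) \<Rightarrow>
   (nat \<Rightarrow> 'w \<Rightarrow> real ^ 'd) \<Rightarrow> (nat \<Rightarrow> 'w \<Rightarrow> real) \<Rightarrow> 'd procedure \<Rightarrow> 'd procedure \<Rightarrow>
   (nat \<Rightarrow> nat) \<Rightarrow> bool" where
  "CV_consistent M P f X Y \<delta>1 \<delta>2 n1 \<longleftrightarrow>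
     (\<lambda>n. measure M {\<omega> \<in> space M. CV_choice X Y \<delta>1 \<delta>2 (n1 n) n \<omega>
            \<noteq> better_index M (Lq_loss 2 P f X Y \<delta>1) (Lq_loss 2 P f X Y \<delta>2)}) \<longlonglongrightarrow> 0"

end

theory Submission
  imports Defs
begin

text \<open>
  Let \<open>D\<close> and \<open>E\<close> be the estimation errors of the better and of the worse procedure, fitted on
  the first \<open>n1\<close> observations. Given these, the difference of the two cross validation criteria is a
  sum of \<open>n2\<close> independent terms \<open>D\<^sup>2 - E\<^sup>2 + 2 * err * (D - E)\<close> with mean \<open>\<parallel>D\<parallel>\<^sup>2 - \<parallel>E\<parallel>\<^sup>2\<close>, which is at
  most a negative multiple of \<open>\<parallel>E\<parallel>\<^sup>2\<close>. By the bound on the ratio of the \<open>L\<^sub>4\<close> and \<open>L\<^sub>2\<close> norms their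
  second moment is at most a constant times \<open>\<parallel>E\<parallel>\<^sup>4 + \<parallel>E\<parallel>\<^sup>2\<close>, so by Chebyshev's inequality the
  conditional probability of a wrong choice is \<open>O(1 / n2 + 1 / (n2 * \<parallel>E\<parallel>\<^sup>2))\<close>. Since \<open>\<parallel>E\<parallel>\<close> is at least
  of the order of \<open>max (p n1) (q n1)\<close>, it suffices that \<open>n2 * (max (p n1) (q n1))\<^sup>2\<close> tends to infinity,
  and both splitting schemes ensure this.
\<close>

section \<open>Sums of independent variables and products of independent blocks\<close>

text \<open>Expanding the square leaves the diagonal: an off-diagonal product of independent centred
  variables integrates to zero. Integrability is concluded as well, because Chebyshev's inequality
  asks for it.\<close>

lemma (in prob_space) indep_vars_mean_zero_sum_squares:
  fixes V :: "'i \<Rightarrow> 'a \<Rightarrow> real"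
  assumes fin: "finite I" and ind: "indep_vars (\<lambda>_. borel) V I"
    and sq: "\<And>i. i \<in> I \<Longrightarrow> integrable M (\<lambda>\<omega>. (V i \<omega>)\<^sup>2)"
    and mean: "\<And>i. i \<in> I \<Longrightarrow> expectation (V i) = 0"
  shows "integrable M (\<lambda>\<omega>. (\<Sum>i\<in>I. V i \<omega>)\<^sup>2)"
    and "expectation (\<lambda>\<omega>. (\<Sum>i\<in>I. V i \<omega>)\<^sup>2) = (\<Sum>i\<in>I. expectation (\<lambda>\<omega>. (V i \<omega>)\<^sup>2))"
proof -
  have rv: "random_variable borel (V i)" if "i \<in> I" for i
    using ind that by (auto simp: indep_vars_def)
  have int: "integrable M (V i)" if "i \<in> I" for i
    by (rule square_integrable_imp_integrable[OF rv sq]) (use that in auto)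
  have pair: "integrable M (\<lambda>\<omega>. V i \<omega> * V j \<omega>) \<and>
      expectation (\<lambda>\<omega>. V i \<omega> * V j \<omega>) = (if i = j then expectation (\<lambda>\<omega>. (V i \<omega>)\<^sup>2) else 0)"
    if ij: "i \<in> I" "j \<in> I" for i j
  proof (cases "i = j")
    case True
    then show ?thesis using sq[OF ij(1)] by (simp add: power2_eq_square)
  next
    case False
    have "indep_vars (\<lambda>_. borel) V {i, j}"
      by (rule indep_vars_subset[OF ind]) (use ij in auto)
    from indep_vars_integrable[OF _ this] indep_vars_lebesgue_integral[OF _ this]
    show ?thesis using False int ij mean by auto
  qed
  have eq: "(\<Sum>i\<in>I. V i \<omega>)\<^sup>2 = (\<Sum>i\<in>I. \<Sum>j\<in>I. V i \<omega> * V j \<omega>)" for \<omega>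
    by (simp add: power2_eq_square sum_product)
  show "integrable M (\<lambda>\<omega>. (\<Sum>i\<in>I. V i \<omega>)\<^sup>2)"
    unfolding eq using pair by (intro Bochner_Integration.integrable_sum) auto
  have "expectation (\<lambda>\<omega>. (\<Sum>i\<in>I. V i \<omega>)\<^sup>2) = (\<Sum>i\<in>I. \<Sum>j\<in>I. expectation (\<lambda>\<omega>. V i \<omega> * V j \<omega>))"
    unfolding eq using pair
    by (subst Bochner_Integration.integral_sum)
       (auto intro!: sum.cong Bochner_Integration.integrable_sum Bochner_Integration.integral_sum)
  also have "\<dots> = (\<Sum>i\<in>I. \<Sum>j\<in>I. if i = j then expectation (\<lambda>\<omega>. (V i \<omega>)\<^sup>2) else 0)"
    using pair by (intro sum.cong) auto
  also have "\<dots> = (\<Sum>i\<in>I. expectation (\<lambda>\<omega>. (V i \<omega>)\<^sup>2))"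
    using fin by (simp add: sum.delta')
  finally show "expectation (\<lambda>\<omega>. (\<Sum>i\<in>I. V i \<omega>)\<^sup>2) = (\<Sum>i\<in>I. expectation (\<lambda>\<omega>. (V i \<omega>)\<^sup>2))" .
qed

text \<open>Chebyshev's inequality under a negative drift: a nonnegative sum exceeds its mean by at
  least \<open>card I * \<mu>\<close>, while its variance is at most \<open>card I * v\<close>.
  Uniform bounds on first and second moments replace identical distributions, since the errors may
  have different laws.\<close>

lemma (in prob_space) indep_vars_sum_nonneg_prob:
  fixes W :: "'i \<Rightarrow> 'a \<Rightarrow> real"
  assumes fin: "finite I" "I \<noteq> {}" and ind: "indep_vars (\<lambda>_. borel) W I"
    and sq: "\<And>i. i \<in> I \<Longrightarrow> integrable M (\<lambda>\<omega>. (W i \<omega>)\<^sup>2)"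
    and mean: "\<And>i. i \<in> I \<Longrightarrow> expectation (W i) \<le> - \<mu>" "\<mu> > 0"
    and second: "\<And>i. i \<in> I \<Longrightarrow> expectation (\<lambda>\<omega>. (W i \<omega>)\<^sup>2) \<le> v"
  shows "prob {\<omega> \<in> space M. (\<Sum>i\<in>I. W i \<omega>) \<ge> 0} \<le> v / (real (card I) * \<mu>\<^sup>2)"
proof -
  define V where "V = (\<lambda>i \<omega>. W i \<omega> - expectation (W i))"
  have rv: "random_variable borel (W i)" if "i \<in> I" for i
    using ind that by (auto simp: indep_vars_def)
  have int: "integrable M (W i)" if "i \<in> I" for i
    by (rule square_integrable_imp_integrable[OF rv sq]) (use that in auto)
  have indV: "indep_vars (\<lambda>_. borel) V I"
    unfolding V_def by (rule indep_vars_compose2[OF ind, of "\<lambda>i x. x - expectation (W i)"]) auto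
  have sqV: "integrable M (\<lambda>\<omega>. (V i \<omega>)\<^sup>2)" if "i \<in> I" for i
    unfolding V_def power2_diff using sq int that by auto
  have meanV: "expectation (V i) = 0" if "i \<in> I" for i
    unfolding V_def using int[OF that] by (simp add: prob_space)
  \<comment> \<open>A variance is at most the second moment, so the uncentred bound \<open>v\<close>
    carries over to \<open>V\<close>.\<close>
  have varV: "expectation (\<lambda>\<omega>. (V i \<omega>)\<^sup>2) \<le> v" if "i \<in> I" for i
    using variance_eq[OF int sq, OF that that] second[OF that]
    by (simp add: V_def) (smt (verit) zero_le_power2)
  have VS: "integrable M (\<lambda>\<omega>. (\<Sum>i\<in>I. V i \<omega>)\<^sup>2)"
    "expectation (\<lambda>\<omega>. (\<Sum>i\<in>I. V i \<omega>)\<^sup>2) = (\<Sum>i\<in>I. expectation (\<lambda>\<omega>. (V i \<omega>)\<^sup>2))"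
    using indep_vars_mean_zero_sum_squares[OF fin(1) indV sqV meanV] by auto
  have rvV: "random_variable borel (\<lambda>\<omega>. \<Sum>i\<in>I. V i \<omega>)"
    unfolding V_def using rv by (intro borel_measurable_sum borel_measurable_diff) auto
  let ?n = "real (card I)"
  have n: "?n > 0" using fin by (simp add: card_gt_0_iff)
  have intV: "integrable M (V i)" if "i \<in> I" for i
    unfolding V_def using int[OF that] by simp
  have mean0: "expectation (\<lambda>\<omega>. \<Sum>i\<in>I. V i \<omega>) = 0"
    using meanV intV by (subst Bochner_Integration.integral_sum) auto
  have "{\<omega> \<in> space M. (\<Sum>i\<in>I. W i \<omega>) \<ge> 0} \<subseteq> {\<omega> \<in> space M. \<bar>(\<Sum>i\<in>I. V i \<omega>)\<bar> \<ge> ?n * \<mu>}"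
  proof safe
    fix \<omega> assume "(\<Sum>i\<in>I. W i \<omega>) \<ge> 0"
    moreover have "(\<Sum>i\<in>I. expectation (W i)) \<le> ?n * - \<mu>"
      using sum_bounded_above[of I "\<lambda>i. expectation (W i)" "-\<mu>"] mean by simp
    ultimately show "\<bar>(\<Sum>i\<in>I. V i \<omega>)\<bar> \<ge> ?n * \<mu>"
      unfolding V_def sum_subtractf by simp
  qed
  then have "prob {\<omega> \<in> space M. (\<Sum>i\<in>I. W i \<omega>) \<ge> 0} \<le> prob {\<omega> \<in> space M. \<bar>(\<Sum>i\<in>I. V i \<omega>)\<bar> \<ge> ?n * \<mu>}"
    using rvV by (intro finite_measure_mono) auto
  also have "\<dots> \<le> expectation (\<lambda>\<omega>. (\<Sum>i\<in>I. V i \<omega>)\<^sup>2) / (?n * \<mu>)\<^sup>2"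
    using Chebyshev_inequality[OF rvV VS(1), of "?n * \<mu>"] n mean(2) unfolding mean0 by simp
  also have "\<dots> \<le> (?n * v) / (?n * \<mu>)\<^sup>2"
    unfolding VS(2) using sum_bounded_above[of I "\<lambda>i. expectation (\<lambda>\<omega>. (V i \<omega>)\<^sup>2)" v] varV
    by (intro divide_right_mono) auto
  also have "\<dots> = v / (?n * \<mu>\<^sup>2)"
    using n by (simp add: power2_eq_square)
  finally show ?thesis .
qed

text \<open>Fubini takes the place of conditioning on \<open>Z1\<close>. The joint law is a product,
  so the probability is an average over \<open>z\<close> of section probabilities; a section over
  \<open>G\<close> costs at most \<open>\<beta>\<close>, any other at most 1.\<close>

lemma (in prob_space) indep_var_event_prob_le:
  assumes ind: "indep_var A Z1 B Z2" and H: "H \<in> sets (A \<Otimes>\<^sub>M B)" and G: "G \<in> sets A"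
    and cond: "\<And>z. z \<in> G \<Longrightarrow> prob {\<omega> \<in> space M. (z, Z2 \<omega>) \<in> H} \<le> \<beta>" and \<beta>: "0 \<le> \<beta>"
  shows "prob {\<omega> \<in> space M. (Z1 \<omega>, Z2 \<omega>) \<in> H} \<le> prob {\<omega> \<in> space M. Z1 \<omega> \<notin> G} + \<beta>"
proof -
  have rv1[measurable]: "Z1 \<in> M \<rightarrow>\<^sub>M A" and rv2[measurable]: "Z2 \<in> M \<rightarrow>\<^sub>M B"
    and eq: "distr M A Z1 \<Otimes>\<^sub>M distr M B Z2 = distr M (A \<Otimes>\<^sub>M B) (\<lambda>x. (Z1 x, Z2 x))"
    using ind unfolding indep_var_distribution_eq by auto
  note [measurable] = H G
  interpret Q2: prob_space "distr M B Z2" by (rule prob_space_distr) simp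
  have "emeasure M {\<omega> \<in> space M. (Z1 \<omega>, Z2 \<omega>) \<in> H} = emeasure (distr M (A \<Otimes>\<^sub>M B) (\<lambda>x. (Z1 x, Z2 x))) H"
    by (subst emeasure_distr) (auto intro!: arg_cong[where f="emeasure M"])
  also have "\<dots> = (\<integral>\<^sup>+z. emeasure (distr M B Z2) (Pair z -` H) \<partial>distr M A Z1)"
    unfolding eq[symmetric] by (rule Q2.emeasure_pair_measure_alt) simp
  also have "\<dots> \<le> (\<integral>\<^sup>+z. indicator (space A - G) z + ennreal \<beta> \<partial>distr M A Z1)"
  proof (rule nn_integral_mono)
    fix z assume "z \<in> space (distr M A Z1)"
    then have z: "z \<in> space A" by simp
    have e: "emeasure (distr M B Z2) (Pair z -` H) = ennreal (prob {\<omega> \<in> space M. (z, Z2 \<omega>) \<in> H})"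
      using z by (subst emeasure_distr)
        (auto intro!: arg_cong[where f="measure M"] sets_Pair1[OF H] simp: emeasure_eq_measure)
    show "emeasure (distr M B Z2) (Pair z -` H) \<le> indicator (space A - G) z + ennreal \<beta>"
    proof (cases "z \<in> G")
      case True
      then show ?thesis unfolding e using cond by (auto intro!: ennreal_leI)
    next
      case False
      have "ennreal (prob {\<omega> \<in> space M. (z, Z2 \<omega>) \<in> H}) \<le> 1" by simp
      then show ?thesis unfolding e using False z by (simp add: add_increasing2)
    qed
  qed
  also have "\<dots> = emeasure M {\<omega> \<in> space M. Z1 \<omega> \<notin> G} + ennreal \<beta>"
  proof -
    interpret Q1: prob_space "distr M A Z1" by (rule prob_space_distr) simp
    have "Z1 -` (space A - G) \<inter> space M = {\<omega> \<in> space M. Z1 \<omega> \<notin> G}"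
      using measurable_space[OF rv1] by auto
    then show ?thesis
      using Q1.emeasure_space_1 by (subst nn_integral_add) (auto simp: emeasure_distr)
  qed
  also have "\<dots> = ennreal (prob {\<omega> \<in> space M. Z1 \<omega> \<notin> G} + \<beta>)"
    using \<beta> by (simp add: emeasure_eq_measure)
  finally show ?thesis
    using \<beta> by (simp add: emeasure_eq_measure del: ennreal_plus)
qed

section \<open>The hold-out comparison of two fixed functions\<close>

context regression_model
begin

section \<open>Transport of integrals to the law of the design points\<close>

lemma sets_P: "sets P = sets (restrict_space borel S)"
  using X_distr[of 1] by (metis order_refl sets_distr)

lemma prob_space_P: "prob_space P"
  using prob_space_distr[OF X_measurable[of 1]] X_distr[of 1] by simp

lemma borel_measurable_P:
  "g \<in> borel_measurable P \<longleftrightarrow> g \<in> borel_measurable (restrict_space borel S)"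
  by (simp add: measurable_cong_sets[OF sets_P refl])

lemma nn_integral_X:
  assumes "i \<ge> 1" "g \<in> borel_measurable (restrict_space borel S)"
  shows "(\<integral>\<^sup>+\<omega>. g (X i \<omega>) \<partial>M) = (\<integral>\<^sup>+x. g x \<partial>P)"
  using nn_integral_distr[OF X_measurable[OF assms(1)], of g] assms
  by (simp add: X_distr borel_measurable_P)

lemma integrable_X:
  fixes g :: "_ \<Rightarrow> real"
  assumes "i \<ge> 1" "g \<in> borel_measurable (restrict_space borel S)"
  shows "integrable M (\<lambda>\<omega>. g (X i \<omega>)) \<longleftrightarrow> integrable P g"
  using integrable_distr_eq[OF X_measurable[OF assms(1)], of g] assms by (simp add: X_distr)

lemma expectation_X:
  fixes g :: "_ \<Rightarrow> real"
  assumes "i \<ge> 1" "g \<in> borel_measurable (restrict_space borel S)"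
  shows "expectation (\<lambda>\<omega>. g (X i \<omega>)) = integral\<^sup>L P g"
  using integral_distr[OF X_measurable[OF assms(1)], of g] assms by (simp add: X_distr)

section \<open>Conditioning on a design point\<close>

lemma subalgebra_sigma_gen:
  assumes "i \<ge> 1"
  shows "finite_measure_subalgebra M (sigma_gen M S (X i))"
proof
  have "X i \<in> space M \<rightarrow> space (restrict_space borel S)"
    using measurable_space[OF X_measurable[OF assms]] by auto
  then show "subalgebra M (sigma_gen M S (X i))"
    unfolding subalgebra_def sigma_gen_def
    using measurable_sets[OF X_measurable[OF assms]] by (auto simp: sets_vimage_algebra2)
qed

lemma X_sigma_gen_measurable:
  assumes "i \<ge> 1"
  shows "X i \<in> sigma_gen M S (X i) \<rightarrow>\<^sub>M restrict_space borel S"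
  unfolding sigma_gen_def using measurable_space[OF X_measurable[OF assms]]
  by (intro measurable_vimage_algebra1) auto

text \<open>The factor \<open>g (X i)\<close> is known given \<open>X i\<close> and can be pulled
  out of the conditional expectation. Squares come first: there everything is nonnegative and no
  integrability is presupposed. The resulting square integrability then allows the same argument for
  the signed product.\<close>

lemma
  fixes g :: "real ^ 'd \<Rightarrow> real"
  assumes i: "i \<ge> 1" and \<sigma>2: "\<sigma>2 \<ge> 0"
    and var: "AE \<omega> in M. nn_cond_exp M (sigma_gen M S (X i)) (\<lambda>\<omega>. ennreal ((err i \<omega>)\<^sup>2)) \<omega> \<le> ennreal \<sigma>2"
    and g: "g \<in> borel_measurable (restrict_space borel S)"
    and sq: "integrable P (\<lambda>x. (g x)\<^sup>2)"
  shows integrable_err_mult_sq: "integrable M (\<lambda>\<omega>. (g (X i \<omega>) * err i \<omega>)\<^sup>2)"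
    and expectation_err_mult_sq: "expectation (\<lambda>\<omega>. (g (X i \<omega>) * err i \<omega>)\<^sup>2) \<le> \<sigma>2 * (\<integral>x. (g x)\<^sup>2 \<partial>P)"
    and integrable_err_mult: "integrable M (\<lambda>\<omega>. g (X i \<omega>) * err i \<omega>)"
    and expectation_err_mult: "expectation (\<lambda>\<omega>. g (X i \<omega>) * err i \<omega>) = 0"
proof -
  interpret F: finite_measure_subalgebra M "sigma_gen M S (X i)"
    by (rule subalgebra_sigma_gen[OF i])
  note [measurable] = X_measurable[OF i] err_measurable[OF i] g
  have gF[measurable]: "(\<lambda>\<omega>. g (X i \<omega>)) \<in> borel_measurable (sigma_gen M S (X i))"
    by (rule measurable_compose[OF X_sigma_gen_measurable[OF i] g])
  have g2: "(\<lambda>\<omega>. ennreal ((g (X i \<omega>))\<^sup>2)) \<in> borel_measurable (sigma_gen M S (X i))" by measurable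
  have e2: "(\<lambda>\<omega>. ennreal ((err i \<omega>)\<^sup>2)) \<in> borel_measurable M" by measurable
  have "(\<integral>\<^sup>+\<omega>. ennreal ((g (X i \<omega>) * err i \<omega>)\<^sup>2) \<partial>M)
      = (\<integral>\<^sup>+\<omega>. ennreal ((g (X i \<omega>))\<^sup>2) * ennreal ((err i \<omega>)\<^sup>2) \<partial>M)"
    by (simp add: power_mult_distrib ennreal_mult)
  also have "\<dots> = (\<integral>\<^sup>+\<omega>. ennreal ((g (X i \<omega>))\<^sup>2) *
      nn_cond_exp M (sigma_gen M S (X i)) (\<lambda>\<omega>. ennreal ((err i \<omega>)\<^sup>2)) \<omega> \<partial>M)"
    by (rule F.nn_cond_exp_intg[OF g2 e2, symmetric])
  also have "\<dots> \<le> (\<integral>\<^sup>+\<omega>. ennreal ((g (X i \<omega>))\<^sup>2) * ennreal \<sigma>2 \<partial>M)"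
  proof (rule nn_integral_mono_AE)
    show "AE \<omega> in M. ennreal ((g (X i \<omega>))\<^sup>2) *
        nn_cond_exp M (sigma_gen M S (X i)) (\<lambda>\<omega>. ennreal ((err i \<omega>)\<^sup>2)) \<omega>
      \<le> ennreal ((g (X i \<omega>))\<^sup>2) * ennreal \<sigma>2"
      using var by eventually_elim (rule mult_left_mono, simp_all)
  qed
  also have "\<dots> = (\<integral>\<^sup>+\<omega>. ennreal ((g (X i \<omega>))\<^sup>2) \<partial>M) * ennreal \<sigma>2"
    by (rule nn_integral_multc) measurable
  also have "(\<integral>\<^sup>+\<omega>. ennreal ((g (X i \<omega>))\<^sup>2) \<partial>M) = (\<integral>\<^sup>+x. ennreal ((g x)\<^sup>2) \<partial>P)"
    by (rule nn_integral_X[OF i]) measurable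
  also have "\<dots> = ennreal (\<integral>x. (g x)\<^sup>2 \<partial>P)"
    by (rule nn_integral_eq_integral[OF sq]) simp
  finally have le: "(\<integral>\<^sup>+\<omega>. ennreal ((g (X i \<omega>) * err i \<omega>)\<^sup>2) \<partial>M) \<le> ennreal (\<sigma>2 * (\<integral>x. (g x)\<^sup>2 \<partial>P))"
    using \<sigma>2 by (simp add: ennreal_mult mult.commute)
  show 1: "integrable M (\<lambda>\<omega>. (g (X i \<omega>) * err i \<omega>)\<^sup>2)"
    by (rule integrableI_nonneg) (use le in \<open>auto intro: le_less_trans\<close>)
  show "expectation (\<lambda>\<omega>. (g (X i \<omega>) * err i \<omega>)\<^sup>2) \<le> \<sigma>2 * (\<integral>x. (g x)\<^sup>2 \<partial>P)"
    using le \<sigma>2 unfolding nn_integral_eq_integral[OF 1, simplified]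
    by (simp add: ennreal_le_iff)
  show 2: "integrable M (\<lambda>\<omega>. g (X i \<omega>) * err i \<omega>)"
    by (rule square_integrable_imp_integrable[OF _ 1]) measurable
  \<comment> \<open>Pulling out the signed factor requires integrability of the whole product, which
    is now available; the conditional mean of the error then vanishes.\<close>
  have "expectation (\<lambda>\<omega>. g (X i \<omega>) * err i \<omega>)
      = expectation (\<lambda>\<omega>. g (X i \<omega>) * real_cond_exp M (sigma_gen M S (X i)) (err i) \<omega>)"
    by (rule F.real_cond_exp_intg(2)[OF 2 gF, symmetric]) measurable
  also have "\<dots> = (\<integral>\<omega>. 0 \<partial>M)"
    using err_mean[OF i] by (intro integral_cong_AE) auto
  finally show "expectation (\<lambda>\<omega>. g (X i \<omega>) * err i \<omega>) = 0" by simp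
qed

text \<open>In \<open>D\<^sup>2 - E\<^sup>2 + 2 * (D - E) * err\<close> the noise part has mean
  zero, so the loss difference alone survives in the mean. For the second moment the two parts are
  separated by an elementary inequality; 16 is the 8 from that separation times the 2 from bounding
  \<open>(D - E)\<^sup>2\<close>.\<close>

lemma
  fixes D E :: "real ^ 'd \<Rightarrow> real"
  assumes i: "i \<ge> 1" and \<sigma>2: "\<sigma>2 \<ge> 0"
    and var: "AE \<omega> in M. nn_cond_exp M (sigma_gen M S (X i)) (\<lambda>\<omega>. ennreal ((err i \<omega>)\<^sup>2)) \<omega> \<le> ennreal \<sigma>2"
    and meas: "D \<in> borel_measurable (restrict_space borel S)" "E \<in> borel_measurable (restrict_space borel S)"
    and sq: "integrable P (\<lambda>x. (D x)\<^sup>2)" "integrable P (\<lambda>x. (E x)\<^sup>2)"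
    and fourth: "integrable P (\<lambda>x. D x ^ 4)" "integrable P (\<lambda>x. E x ^ 4)"
  defines "W \<equiv> \<lambda>\<omega>. (err i \<omega> + D (X i \<omega>))\<^sup>2 - (err i \<omega> + E (X i \<omega>))\<^sup>2"
  shows expectation_score_diff: "expectation W = (\<integral>x. (D x)\<^sup>2 \<partial>P) - (\<integral>x. (E x)\<^sup>2 \<partial>P)"
    and integrable_score_diff_sq: "integrable M (\<lambda>\<omega>. (W \<omega>)\<^sup>2)"
    and expectation_score_diff_sq: "expectation (\<lambda>\<omega>. (W \<omega>)\<^sup>2) \<le>
      2 * ((\<integral>x. D x ^ 4 \<partial>P) + (\<integral>x. E x ^ 4 \<partial>P)) + 16 * \<sigma>2 * ((\<integral>x. (D x)\<^sup>2 \<partial>P) + (\<integral>x. (E x)\<^sup>2 \<partial>P))"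
proof -
  note [measurable] = X_measurable[OF i] err_measurable[OF i] meas
  let ?g = "\<lambda>x. D x - E x"
  have g2: "(?g x)\<^sup>2 \<le> 2 * ((D x)\<^sup>2 + (E x)\<^sup>2)" for x
    using zero_le_power2[of "D x + E x"] by (simp add: power2_eq_square algebra_simps)
  have gi: "integrable P (\<lambda>x. (?g x)\<^sup>2)"
  proof (rule Bochner_Integration.integrable_bound)
    show "integrable P (\<lambda>x. 2 * ((D x)\<^sup>2 + (E x)\<^sup>2))" using sq by simp
    show "(\<lambda>x. (?g x)\<^sup>2) \<in> borel_measurable P" unfolding borel_measurable_P by measurable
    show "AE x in P. norm ((?g x)\<^sup>2) \<le> norm (2 * ((D x)\<^sup>2 + (E x)\<^sup>2))"
      using g2 by simp
  qed
  have gm: "?g \<in> borel_measurable (restrict_space borel S)" by measurable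
  note e = integrable_err_mult_sq[OF i \<sigma>2 var gm gi] expectation_err_mult_sq[OF i \<sigma>2 var gm gi]
    integrable_err_mult[OF i \<sigma>2 var gm gi] expectation_err_mult[OF i \<sigma>2 var gm gi]
  have XI: "integrable M (\<lambda>\<omega>. (D (X i \<omega>))\<^sup>2)" "integrable M (\<lambda>\<omega>. (E (X i \<omega>))\<^sup>2)"
    "integrable M (\<lambda>\<omega>. D (X i \<omega>) ^ 4)" "integrable M (\<lambda>\<omega>. E (X i \<omega>) ^ 4)"
    using sq fourth by (subst integrable_X[OF i]; measurable)+
  have XE: "expectation (\<lambda>\<omega>. (D (X i \<omega>))\<^sup>2) = (\<integral>x. (D x)\<^sup>2 \<partial>P)"
    "expectation (\<lambda>\<omega>. (E (X i \<omega>))\<^sup>2) = (\<integral>x. (E x)\<^sup>2 \<partial>P)"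
    "expectation (\<lambda>\<omega>. D (X i \<omega>) ^ 4) = (\<integral>x. D x ^ 4 \<partial>P)"
    "expectation (\<lambda>\<omega>. E (X i \<omega>) ^ 4) = (\<integral>x. E x ^ 4 \<partial>P)"
    by (rule expectation_X[OF i]; measurable)+
  have W: "W = (\<lambda>\<omega>. ((D (X i \<omega>))\<^sup>2 - (E (X i \<omega>))\<^sup>2) + 2 * (?g (X i \<omega>) * err i \<omega>))"
    unfolding W_def by (auto simp: power2_eq_square algebra_simps)
  show "expectation W = (\<integral>x. (D x)\<^sup>2 \<partial>P) - (\<integral>x. (E x)\<^sup>2 \<partial>P)"
    unfolding W using XI e(3,4) by (simp add: XE)
  let ?B = "\<lambda>\<omega>. 2 * (D (X i \<omega>) ^ 4 + E (X i \<omega>) ^ 4) + 8 * (?g (X i \<omega>) * err i \<omega>)\<^sup>2"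
  have le: "(W \<omega>)\<^sup>2 \<le> ?B \<omega>" for \<omega>
  proof -
    have "(a + 2 * b)\<^sup>2 \<le> 2 * a\<^sup>2 + 8 * b\<^sup>2" for a b :: real
      using zero_le_power2[of "a - 2 * b"] by (simp add: power2_eq_square algebra_simps)
    moreover have "(d\<^sup>2 - e\<^sup>2)\<^sup>2 \<le> d ^ 4 + e ^ 4" for d e :: real
    proof -
      have "(d\<^sup>2 - e\<^sup>2)\<^sup>2 = d ^ 4 + e ^ 4 - 2 * (d * e)\<^sup>2" by algebra
      then show ?thesis by simp
    qed
    ultimately show ?thesis unfolding W by (smt (verit) mult_left_mono)
  qed
  have BI: "integrable M ?B" using XI e(1) by auto
  have "W \<in> borel_measurable M" unfolding W_def by measurable
  then show 1: "integrable M (\<lambda>\<omega>. (W \<omega>)\<^sup>2)"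
  proof (rule Bochner_Integration.integrable_bound[OF BI borel_measurable_power])
    show "AE \<omega> in M. norm ((W \<omega>)\<^sup>2) \<le> norm (?B \<omega>)"
      using le by (intro AE_I2) (smt (verit) real_norm_def zero_le_power2)
  qed
  have "(\<integral>x. (?g x)\<^sup>2 \<partial>P) \<le> (\<integral>x. 2 * ((D x)\<^sup>2 + (E x)\<^sup>2) \<partial>P)"
    by (rule integral_mono[OF gi _ g2]) (use sq in auto)
  also have "\<dots> = 2 * ((\<integral>x. (D x)\<^sup>2 \<partial>P) + (\<integral>x. (E x)\<^sup>2 \<partial>P))"
    using sq by simp
  finally have g_le: "\<sigma>2 * (\<integral>x. (?g x)\<^sup>2 \<partial>P) \<le> \<sigma>2 * (2 * ((\<integral>x. (D x)\<^sup>2 \<partial>P) + (\<integral>x. (E x)\<^sup>2 \<partial>P)))"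
    using \<sigma>2 by (rule mult_left_mono)
  have "expectation (\<lambda>\<omega>. (W \<omega>)\<^sup>2) \<le> expectation ?B"
    by (rule integral_mono[OF 1 BI le])
  also have "\<dots> = 2 * ((\<integral>x. D x ^ 4 \<partial>P) + (\<integral>x. E x ^ 4 \<partial>P)) + 8 * expectation (\<lambda>\<omega>. (?g (X i \<omega>) * err i \<omega>)\<^sup>2)"
    using XI e(1) by (simp add: XE)
  finally show "expectation (\<lambda>\<omega>. (W \<omega>)\<^sup>2) \<le>
      2 * ((\<integral>x. D x ^ 4 \<partial>P) + (\<integral>x. E x ^ 4 \<partial>P)) + 16 * \<sigma>2 * ((\<integral>x. (D x)\<^sup>2 \<partial>P) + (\<integral>x. (E x)\<^sup>2 \<partial>P))"
    using e(2) g_le by (simp add: algebra_simps)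
qed

text \<open>With \<open>b\<close> the squared loss of the worse fit, each term has mean at most
  \<open>- b * (1 - 1 / r)\<close>. In the second moment the fourth-power part is of order
  \<open>b\<^sup>2\<close>, matching the squared mean, but the noise part is only of order
  \<open>b\<close>; hence the lower bound \<open>t\<close> on \<open>b\<close> in the
  estimate.\<close>

lemma holdout_error_prob_le:
  fixes u v :: "real ^ 'd \<Rightarrow> real"
  assumes I: "finite I" "I \<noteq> {}" "I \<subseteq> {1..}" and \<sigma>2: "\<sigma>2 \<ge> 0"
    and var: "\<And>i. i \<ge> 1 \<Longrightarrow>
      AE \<omega> in M. nn_cond_exp M (sigma_gen M S (X i)) (\<lambda>\<omega>. ennreal ((err i \<omega>)\<^sup>2)) \<omega> \<le> ennreal \<sigma>2"
    and meas: "u \<in> borel_measurable (restrict_space borel S)" "v \<in> borel_measurable (restrict_space borel S)"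
  defines "D \<equiv> \<lambda>x. f x - u x" and "E \<equiv> \<lambda>x. f x - v x"
  assumes sq: "integrable P (\<lambda>x. (D x)\<^sup>2)" "integrable P (\<lambda>x. (E x)\<^sup>2)"
    and fourth: "integrable P (\<lambda>x. D x ^ 4)" "integrable P (\<lambda>x. E x ^ 4)"
    and K: "K \<ge> 0" "(\<integral>x. D x ^ 4 \<partial>P) \<le> K * (\<integral>x. (D x)\<^sup>2 \<partial>P)\<^sup>2" "(\<integral>x. E x ^ 4 \<partial>P) \<le> K * (\<integral>x. (E x)\<^sup>2 \<partial>P)\<^sup>2"
    and r: "r > 1" "r * (\<integral>x. (D x)\<^sup>2 \<partial>P) \<le> (\<integral>x. (E x)\<^sup>2 \<partial>P)"
    and t: "0 < t" "t \<le> (\<integral>x. (E x)\<^sup>2 \<partial>P)"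
  shows "prob {\<omega> \<in> space M. (\<Sum>i\<in>I. (Y i \<omega> - u (X i \<omega>))\<^sup>2 - (Y i \<omega> - v (X i \<omega>))\<^sup>2) \<ge> 0}
    \<le> (4 * K + 32 * \<sigma>2 / t) / (real (card I) * (1 - 1 / r)\<^sup>2)"
proof -
  define W where "W i \<omega> = (Y i \<omega> - u (X i \<omega>))\<^sup>2 - (Y i \<omega> - v (X i \<omega>))\<^sup>2" for i \<omega>
  define a where "a = (\<integral>x. (D x)\<^sup>2 \<partial>P)"
  define b where "b = (\<integral>x. (E x)\<^sup>2 \<partial>P)"
  note [measurable] = f_measurable meas
  have a0: "a \<ge> 0" unfolding a_def by simp
  have b0: "b > 0" using t unfolding b_def by linarith
  have rab: "a \<le> b / r" using r unfolding a_def b_def by (simp add: field_simps)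
  have "b / r < b" using r b0 by (simp add: field_simps)
  then have ab: "a < b" using rab by linarith
  have Dm: "D \<in> borel_measurable (restrict_space borel S)" "E \<in> borel_measurable (restrict_space borel S)"
    unfolding D_def E_def by measurable
  have Weq: "W i \<omega> = (err i \<omega> + D (X i \<omega>))\<^sup>2 - (err i \<omega> + E (X i \<omega>))\<^sup>2" if "i \<in> I" "\<omega> \<in> space M" for i \<omega>
    using model[of i \<omega>] that I by (auto simp: W_def D_def E_def algebra_simps)
  have ind: "indep_vars (\<lambda>_. borel) W I"
    \<comment> \<open>Independence is assumed for the pairs \<open>(X i, Y i)\<close>, so the scores
      are written through \<open>Y\<close> here; \<open>Weq\<close> passes to the errors when
      moments are computed.\<close>
    unfolding W_def
    by (rule indep_vars_compose2[OF indep_vars_subset[OF indep I(3)],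
          of "\<lambda>_ z. (snd z - u (fst z))\<^sup>2 - (snd z - v (fst z))\<^sup>2", simplified]) measurable
  have mean: "expectation (W i) \<le> - (b - a)"
    and int: "integrable M (\<lambda>\<omega>. (W i \<omega>)\<^sup>2)"
    and second: "expectation (\<lambda>\<omega>. (W i \<omega>)\<^sup>2) \<le> 4 * K * b\<^sup>2 + 32 * \<sigma>2 * b" if i: "i \<in> I" for i
  proof -
    have i1: "i \<ge> 1" using i I by auto
    note s = expectation_score_diff[OF i1 \<sigma>2 var[OF i1] Dm sq fourth]
      integrable_score_diff_sq[OF i1 \<sigma>2 var[OF i1] Dm sq fourth]
      expectation_score_diff_sq[OF i1 \<sigma>2 var[OF i1] Dm sq fourth]
    show "expectation (W i) \<le> - (b - a)"
      using s(1) Weq[OF i] by (simp add: a_def b_def cong: Bochner_Integration.integral_cong)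
    show "integrable M (\<lambda>\<omega>. (W i \<omega>)\<^sup>2)"
      using s(2) Weq[OF i] by (simp cong: Bochner_Integration.integrable_cong)
    have "expectation (\<lambda>\<omega>. (W i \<omega>)\<^sup>2) \<le> 2 * (K * a\<^sup>2 + K * b\<^sup>2) + 16 * \<sigma>2 * (a + b)"
      using s(3) Weq[OF i] K by (simp add: a_def b_def cong: Bochner_Integration.integral_cong)
    \<comment> \<open>Since \<open>a < b\<close>, the better fit is absorbed into the worse one;
      this doubles the \<open>b\<close> terms and yields 4 and 32.\<close>
    also have "\<dots> \<le> 2 * (K * b\<^sup>2 + K * b\<^sup>2) + 16 * \<sigma>2 * (b + b)"
      using ab a0 K \<sigma>2 by (intro add_mono mult_left_mono power_mono) auto
    finally show "expectation (\<lambda>\<omega>. (W i \<omega>)\<^sup>2) \<le> 4 * K * b\<^sup>2 + 32 * \<sigma>2 * b" by simp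
  qed
  have n: "real (card I) > 0" using I by (simp add: card_gt_0_iff)
  have \<mu>: "b * (1 - 1 / r) \<le> b - a" using rab by (simp add: algebra_simps)
  have r1: "0 < 1 - 1 / r" using r by simp
  have "prob {\<omega> \<in> space M. (\<Sum>i\<in>I. W i \<omega>) \<ge> 0} \<le> (4 * K * b\<^sup>2 + 32 * \<sigma>2 * b) / (real (card I) * (b - a)\<^sup>2)"
    by (rule indep_vars_sum_nonneg_prob[OF I(1,2) ind int mean _ second]) (use ab in auto)
  \<comment> \<open>Replacing the gap \<open>b - a\<close> by a fixed fraction of \<open>b\<close>
    makes \<open>b\<^sup>2\<close> a common factor that cancels in the next step.\<close>
  also have "\<dots> \<le> (4 * K * b\<^sup>2 + 32 * \<sigma>2 * b) / (real (card I) * (b * (1 - 1 / r))\<^sup>2)"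
    using \<mu> r1 n b0 K(1) \<sigma>2 ab
    by (intro divide_left_mono mult_left_mono power_mono mult_pos_pos zero_less_power) auto
  also have "\<dots> = (4 * K + 32 * \<sigma>2 / b) / (real (card I) * (1 - 1 / r)\<^sup>2)"
  proof -
    have "4 * K * b\<^sup>2 + 32 * \<sigma>2 * b = b\<^sup>2 * (4 * K + 32 * \<sigma>2 / b)"
      using b0 by (simp add: power2_eq_square algebra_simps)
    moreover have "real (card I) * (b * (1 - 1 / r))\<^sup>2 = b\<^sup>2 * (real (card I) * (1 - 1 / r)\<^sup>2)"
      by (simp add: power_mult_distrib)
    moreover have "b\<^sup>2 \<noteq> 0" using b0 by simp
    ultimately show ?thesis by (metis mult_divide_mult_cancel_left)
  qed
  also have "\<dots> \<le> (4 * K + 32 * \<sigma>2 / t) / (real (card I) * (1 - 1 / r)\<^sup>2)"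
    using t \<sigma>2 n b0 unfolding b_def
    by (intro divide_right_mono add_left_mono divide_left_mono) auto
  finally show ?thesis unfolding W_def .
qed

end

section \<open>Conditioning on the estimation data\<close>

text \<open>Evenness turns \<open>\<bar>g x\<bar> powr real k\<close> into \<open>g x ^ k\<close>,
  so norms become ordinary integrals. Finiteness excludes the infinite branch of
  \<open>Lq_norm\<close>, where \<open>enn2real\<close> would return 0.\<close>

lemma Lq_norm_finite_even:
  assumes g: "g \<in> borel_measurable Q" and k: "even k" "0 < k" and fin: "Lq_norm (real k) Q g < \<infinity>"
  shows "integrable Q (\<lambda>x. g x ^ k)"
    and "(\<integral>x. g x ^ k \<partial>Q) = enn2real (Lq_norm (real k) Q g) ^ k"
proof -
  have eq: "\<bar>g x\<bar> powr real k = g x ^ k" for x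
    using k powr_realpow'[of "\<bar>g x\<bar>" k] by (simp add: power_even_abs)
  define I where "I = (\<integral>\<^sup>+ x. ennreal (g x ^ k) \<partial>Q)"
  have L: "Lq_norm (real k) Q g = (if I = \<infinity> then \<infinity> else ennreal (enn2real I powr (1 / real k)))"
    unfolding Lq_norm_def eq I_def Let_def ..
  have I: "I < \<infinity>" using fin unfolding L by (auto simp: less_top split: if_splits)
  have pos: "g x ^ k \<ge> 0" for x using k by (simp add: zero_le_even_power)
  show "integrable Q (\<lambda>x. g x ^ k)"
    by (rule integrableI_nonneg) (use g pos I in \<open>auto simp: I_def\<close>)
  have "(\<integral>x. g x ^ k \<partial>Q) = enn2real I"
    unfolding I_def by (rule integral_eq_nn_integral) (use g pos in auto)
  also have "\<dots> = (enn2real I powr (1 / real k)) ^ k"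
    using k powr_realpow'[of "enn2real I powr (1 / real k)" k] by (simp add: powr_powr)
  also have "enn2real I powr (1 / real k) = enn2real (Lq_norm (real k) Q g)"
    unfolding L using I by auto
  finally show "(\<integral>x. g x ^ k \<partial>Q) = enn2real (Lq_norm (real k) Q g) ^ k" .
qed

text \<open>The conditions on \<open>b\<close> guard against conventions at the ends of the scale:
  dividing by \<infinity> gives 0 whatever \<open>a\<close> is, and for \<open>b = 0\<close> the
  product \<open>c * b\<close> is 0 even when \<open>c\<close> is infinite.\<close>

lemma ennreal_le_mult_of_divide_le:
  fixes a b :: ennreal
  assumes "a / b \<le> c" "0 < b" "b < \<infinity>"
  shows "a \<le> c * b"
proof -
  have "a = a / b * b" using assms by (simp add: ennreal_divide_times ennreal_mult_divide_eq)
  also have "\<dots> \<le> c * b" using assms by (intro mult_right_mono) auto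
  finally show ?thesis .
qed

text \<open>Clearing the denominator and taking fourth powers gives the bound, because the fourth
  power of the L2 norm is the square of the second moment. This supplies the constant
  \<open>K\<close> of the hold-out estimate as \<open>C ^ 4\<close>.\<close>

lemma Lq_norm_4_le:
  assumes g: "g \<in> borel_measurable Q" and "0 < Lq_norm 2 Q g" "Lq_norm 2 Q g < \<infinity>"
    and ratio: "Lq_norm 4 Q g / Lq_norm 2 Q g \<le> ennreal C" and C: "C \<ge> 0"
  shows "integrable Q (\<lambda>x. g x ^ 4)"
    and "(\<integral>x. g x ^ 4 \<partial>Q) \<le> C ^ 4 * (\<integral>x. (g x)\<^sup>2 \<partial>Q)\<^sup>2"
proof -
  have le: "Lq_norm 4 Q g \<le> ennreal C * Lq_norm 2 Q g"
    using assms by (intro ennreal_le_mult_of_divide_le) auto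
  also have lt: "\<dots> < \<infinity>" using assms by (simp add: ennreal_mult_less_top)
  finally have fin4: "Lq_norm 4 Q g < \<infinity>" .
  note n2 = Lq_norm_finite_even[OF g, of 2, simplified, OF assms(3)[simplified]]
  note n4 = Lq_norm_finite_even[OF g, of 4, simplified, OF fin4[simplified]]
  show "integrable Q (\<lambda>x. g x ^ 4)" by (rule n4)
  have "enn2real (Lq_norm 4 Q g) \<le> C * enn2real (Lq_norm 2 Q g)"
    using enn2real_mono[OF le] lt C by (simp add: enn2real_mult)
  then have "enn2real (Lq_norm 4 Q g) ^ 4 \<le> (C * enn2real (Lq_norm 2 Q g)) ^ 4"
    by (intro power_mono) auto
  then show "(\<integral>x. g x ^ 4 \<partial>Q) \<le> C ^ 4 * (\<integral>x. (g x)\<^sup>2 \<partial>Q)\<^sup>2"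
    unfolding n2 n4 by (simp add: power_mult_distrib)
qed

lemma (in prob_space) prob_not_conj_le:
  assumes "{\<omega> \<in> space M. P \<omega>} \<in> events" "{\<omega> \<in> space M. Q \<omega>} \<in> events"
    and le: "prob {\<omega> \<in> space M. \<not> P \<omega>} \<le> a" "prob {\<omega> \<in> space M. \<not> Q \<omega>} \<le> b"
  shows "prob {\<omega> \<in> space M. \<not> (P \<omega> \<and> Q \<omega>)} \<le> a + b"
proof -
  have m: "{\<omega> \<in> space M. \<not> P \<omega>} \<in> events" "{\<omega> \<in> space M. \<not> Q \<omega>} \<in> events"
    using assms by auto
  have "{\<omega> \<in> space M. \<not> (P \<omega> \<and> Q \<omega>)} = {\<omega> \<in> space M. \<not> P \<omega>} \<union> {\<omega> \<in> space M. \<not> Q \<omega>}" by auto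
  then show ?thesis using measure_Un_le[OF m] le by simp
qed

context regression_model
begin

section \<open>Samples and measurability of the fits\<close>

abbreviation sample_space :: "nat set \<Rightarrow> (nat \<Rightarrow> (real ^ 'd) \<times> real) measure" where
  "sample_space I \<equiv> PiM I (\<lambda>_. restrict_space borel S \<Otimes>\<^sub>M borel)"

abbreviation sample :: "nat set \<Rightarrow> 'w \<Rightarrow> nat \<Rightarrow> (real ^ 'd) \<times> real" where
  "sample I \<omega> \<equiv> \<lambda>i\<in>I. (X i \<omega>, Y i \<omega>)"

lemma sample_measurable:
  assumes "I \<subseteq> {1..}"
  shows "sample I \<in> M \<rightarrow>\<^sub>M sample_space I"
proof (rule measurable_restrict)
  fix i assume "i \<in> I"
  then show "(\<lambda>\<omega>. (X i \<omega>, Y i \<omega>)) \<in> M \<rightarrow>\<^sub>M restrict_space borel S \<Otimes>\<^sub>M borel"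
    using indep assms by (auto simp: indep_vars_def)
qed

text \<open>By Tonelli, joint measurability of the procedure in sample and point makes the inner
  integral measurable in the sample. Losses and the event \<open>comparable_fits\<close> thereby
  become measurable.\<close>

lemma Lq_norm_fit_measurable:
  assumes "regression_procedure S \<delta>" "n \<ge> 1"
  shows "(\<lambda>z. Lq_norm k P (\<lambda>x. f x - \<delta> n z x)) \<in> borel_measurable (sample_space {1..n})"
proof -
  interpret P: prob_space P by (rule prob_space_P)
  have [measurable]: "case_prod (\<delta> n) \<in> borel_measurable (sample_space {1..n} \<Otimes>\<^sub>M P)"
    using assms unfolding regression_procedure_def
    by (auto simp: measurable_cong_sets[OF sets_pair_measure_cong[OF refl sets_P] refl])
  have [measurable]: "f \<in> borel_measurable P" using f_measurable by (simp add: borel_measurable_P)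
  have "case_prod (\<lambda>z x. ennreal (\<bar>f x - \<delta> n z x\<bar> powr k)) \<in> borel_measurable (sample_space {1..n} \<Otimes>\<^sub>M P)"
    by measurable
  from P.borel_measurable_nn_integral[OF this]
  have [measurable]: "(\<lambda>z. \<integral>\<^sup>+ x. ennreal (\<bar>f x - \<delta> n z x\<bar> powr k) \<partial>P) \<in> borel_measurable (sample_space {1..n})" .
  show ?thesis unfolding Lq_norm_def Let_def by measurable
qed

lemma Lq_loss_eq: "Lq_loss k P f X Y \<delta> n \<omega> = Lq_norm k P (\<lambda>x. f x - \<delta> n (sample {1..n} \<omega>) x)"
  by (simp add: Lq_loss_def estimator_def)

lemma Lq_loss_measurable:
  assumes "regression_procedure S \<delta>" "n \<ge> 1"
  shows "Lq_loss k P f X Y \<delta> n \<in> borel_measurable M"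
  using measurable_compose[OF sample_measurable[of "{1..n}"] Lq_norm_fit_measurable[OF assms, of k]]
  by (auto simp: Lq_loss_eq[abs_def])

lemma procedure_section_measurable:
  assumes "regression_procedure S \<delta>" "n \<ge> 1" "z \<in> space (sample_space {1..n})"
  shows "\<delta> n z \<in> borel_measurable (restrict_space borel S)"
  using measurable_compose_Pair1[OF assms(3), of "case_prod (\<delta> n)"] assms(1,2)
  unfolding regression_procedure_def by auto

text \<open>The event on the estimation data under which the hold-out comparison is reliable; \<open>u\<close> is the better fit.\<close>

definition comparable_fits ::
  "real \<Rightarrow> real \<Rightarrow> real \<Rightarrow> (real ^ 'd \<Rightarrow> real) \<Rightarrow> (real ^ 'd \<Rightarrow> real) \<Rightarrow> bool" where
  "comparable_fits c s C u v \<longleftrightarrow>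
     (let D = (\<lambda>x. f x - u x); E = (\<lambda>x. f x - v x) in
     0 < Lq_norm 2 P D \<and> Lq_norm 2 P E < \<infinity> \<and> ennreal s \<le> Lq_norm 2 P E \<and>
     ennreal (1 + c) * Lq_norm 2 P D \<le> Lq_norm 2 P E \<and>
     Lq_norm 4 P D / Lq_norm 2 P D \<le> ennreal C \<and> Lq_norm 4 P E / Lq_norm 2 P E \<le> ennreal C)"

text \<open>Translation from norms to moments: the hold-out estimate is used with
  \<open>K = C ^ 4\<close>, \<open>r = (1 + c)\<^sup>2\<close> and \<open>t = s\<^sup>2\<close>. The
  positive norm of \<open>D\<close> and the lower bound \<open>s\<close> for that of
  \<open>E\<close> legitimise clearing the two quotients.\<close>

lemma comparable_holdout_error_prob_le:
  assumes I: "finite I" "I \<noteq> {}" "I \<subseteq> {1..}" and \<sigma>2: "\<sigma>2 \<ge> 0"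
    and var: "\<And>i. i \<ge> 1 \<Longrightarrow>
      AE \<omega> in M. nn_cond_exp M (sigma_gen M S (X i)) (\<lambda>\<omega>. ennreal ((err i \<omega>)\<^sup>2)) \<omega> \<le> ennreal \<sigma>2"
    and meas: "u \<in> borel_measurable (restrict_space borel S)" "v \<in> borel_measurable (restrict_space borel S)"
    and comp: "comparable_fits c s C u v" and c: "c > 0" and s: "s > 0" and C: "C \<ge> 0"
  shows "prob {\<omega> \<in> space M. (\<Sum>i\<in>I. (Y i \<omega> - u (X i \<omega>))\<^sup>2 - (Y i \<omega> - v (X i \<omega>))\<^sup>2) \<ge> 0}
    \<le> (4 * C ^ 4 + 32 * \<sigma>2 / s\<^sup>2) / (real (card I) * (1 - 1 / (1 + c)\<^sup>2)\<^sup>2)"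
proof -
  define D where "D = (\<lambda>x. f x - u x)"
  define E where "E = (\<lambda>x. f x - v x)"
  have DE: "D \<in> borel_measurable P" "E \<in> borel_measurable P"
    unfolding D_def E_def borel_measurable_P using f_measurable meas by measurable
  have h: "0 < Lq_norm 2 P D" "Lq_norm 2 P E < \<infinity>" "ennreal s \<le> Lq_norm 2 P E"
    "ennreal (1 + c) * Lq_norm 2 P D \<le> Lq_norm 2 P E"
    "Lq_norm 4 P D / Lq_norm 2 P D \<le> ennreal C" "Lq_norm 4 P E / Lq_norm 2 P E \<le> ennreal C"
    using comp unfolding comparable_fits_def D_def E_def Let_def by auto
  \<comment> \<open>As \<open>1 + c\<close> is at least 1, the better norm lies below the worse one
    and inherits its finiteness.\<close>
  have "Lq_norm 2 P D \<le> ennreal (1 + c) * Lq_norm 2 P D"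
    using mult_right_mono[of 1 "ennreal (1 + c)" "Lq_norm 2 P D"] c by simp
  then have Dfin: "Lq_norm 2 P D < \<infinity>" using h(2,4) by (meson le_less_trans order_trans)
  have Epos: "0 < Lq_norm 2 P E" using h(3) s by (meson ennreal_less_zero_iff less_le_trans)
  note D2 = Lq_norm_finite_even[OF DE(1), of 2, simplified, OF Dfin[simplified]]
  note E2 = Lq_norm_finite_even[OF DE(2), of 2, simplified, OF h(2)[simplified]]
  note D4 = Lq_norm_4_le[OF DE(1) h(1) Dfin h(5) C]
  note E4 = Lq_norm_4_le[OF DE(2) Epos h(2) h(6) C]
  have "(1 + c) * enn2real (Lq_norm 2 P D) \<le> enn2real (Lq_norm 2 P E)"
    using enn2real_mono[OF h(4)] h(2) c by (simp add: enn2real_mult del: ennreal_plus)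
  from power_mono[OF this, of 2] have r: "(1 + c)\<^sup>2 * (\<integral>x. (D x)\<^sup>2 \<partial>P) \<le> (\<integral>x. (E x)\<^sup>2 \<partial>P)"
    unfolding D2 E2 using c by (simp add: power_mult_distrib)
  have "s \<le> enn2real (Lq_norm 2 P E)"
    using enn2real_mono[OF h(3)] h(2) s by simp
  from power_mono[OF this, of 2] have t: "s\<^sup>2 \<le> (\<integral>x. (E x)\<^sup>2 \<partial>P)"
    unfolding E2 using s by simp
  have r1: "1 < (1 + c)\<^sup>2" using c by (intro one_less_power) auto
  show ?thesis
    by (rule holdout_error_prob_le[OF I \<sigma>2 var meas D2(1)[unfolded D_def] E2(1)[unfolded E_def]
          D4(1)[unfolded D_def] E4(1)[unfolded E_def] _ D4(2)[unfolded D_def] E4(2)[unfolded E_def]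
          r1 r[unfolded D_def E_def] _ t[unfolded E_def]])
       (use s C in auto)
qed

text \<open>Estimation and hold-out data are independent blocks, and once the estimation sample is
  frozen the fits are fixed functions, to which the previous bound applies. Ties count as errors, so
  the result is usable whichever procedure carries the first index.\<close>

lemma CV_error_prob_le:
  assumes proc: "regression_procedure S \<delta>1" "regression_procedure S \<delta>2"
    and mn: "1 \<le> m" "m < n" and \<sigma>2: "\<sigma>2 \<ge> 0"
    and var: "\<And>i. i \<ge> 1 \<Longrightarrow>
      AE \<omega> in M. nn_cond_exp M (sigma_gen M S (X i)) (\<lambda>\<omega>. ennreal ((err i \<omega>)\<^sup>2)) \<omega> \<le> ennreal \<sigma>2"
    and c: "c > 0" and s: "s > 0" and C: "C \<ge> 0"
  shows "prob {\<omega> \<in> space M. CV_criterion X Y \<delta>2 m n \<omega> \<le> CV_criterion X Y \<delta>1 m n \<omega>}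
    \<le> prob {\<omega> \<in> space M. \<not> comparable_fits c s C (estimator X Y \<delta>1 m \<omega>) (estimator X Y \<delta>2 m \<omega>)}
      + (4 * C ^ 4 + 32 * \<sigma>2 / s\<^sup>2) / (real (n - m) * (1 - 1 / (1 + c)\<^sup>2)\<^sup>2)"
proof -
  let ?A = "sample_space {1..m}" and ?B = "sample_space {Suc m..n}"
  have [measurable]: "case_prod (\<delta>1 m) \<in> borel_measurable (?A \<Otimes>\<^sub>M restrict_space borel S)"
    "case_prod (\<delta>2 m) \<in> borel_measurable (?A \<Otimes>\<^sub>M restrict_space borel S)"
    using proc mn unfolding regression_procedure_def by auto
  \<comment> \<open>\<open>T\<close> keeps the estimation sample \<open>z\<close> and the hold-out
    sample \<open>w\<close> apart, the form in which the product law can be used.\<close>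
  define T where "T z w = (\<Sum>i\<in>{Suc m..n}. (snd (w i) - \<delta>1 m z (fst (w i)))\<^sup>2 - (snd (w i) - \<delta>2 m z (fst (w i)))\<^sup>2)"
    for z w
  define H where "H = {zw \<in> space (?A \<Otimes>\<^sub>M ?B). 0 \<le> T (fst zw) (snd zw)}"
  define G where "G = {z \<in> space ?A. comparable_fits c s C (\<delta>1 m z) (\<delta>2 m z)}"
  note fit[measurable] = Lq_norm_fit_measurable[OF proc(1) mn(1)] Lq_norm_fit_measurable[OF proc(2) mn(1)]
  have ind: "indep_var ?A (sample {1..m}) ?B (sample {Suc m..n})"
    by (rule indep_var_restrict[OF indep]) auto
  have comp: "(\<lambda>zw. snd zw i) \<in> ?A \<Otimes>\<^sub>M ?B \<rightarrow>\<^sub>M restrict_space borel S \<Otimes>\<^sub>M borel" if "i \<in> {Suc m..n}" for i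
    using measurable_compose[OF measurable_snd measurable_component_singleton[OF that]] .
  have Tm: "(\<lambda>zw. T (fst zw) (snd zw)) \<in> borel_measurable (?A \<Otimes>\<^sub>M ?B)"
    unfolding T_def
  proof (rule borel_measurable_sum)
    fix i assume "i \<in> {Suc m..n}"
    note [measurable] = comp[OF this]
    \<comment> \<open>A random fit is evaluated at a random hold-out point, so measurability of each
      section would be too little; joint measurability is composed with the pair of sample and
      point.\<close>
    have "(\<lambda>zw. case_prod (\<delta>1 m) (fst zw, fst (snd zw i))) \<in> borel_measurable (?A \<Otimes>\<^sub>M ?B)"
      "(\<lambda>zw. case_prod (\<delta>2 m) (fst zw, fst (snd zw i))) \<in> borel_measurable (?A \<Otimes>\<^sub>M ?B)"
      by measurable
    then have [measurable]: "(\<lambda>zw. \<delta>1 m (fst zw) (fst (snd zw i))) \<in> borel_measurable (?A \<Otimes>\<^sub>M ?B)"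
      "(\<lambda>zw. \<delta>2 m (fst zw) (fst (snd zw i))) \<in> borel_measurable (?A \<Otimes>\<^sub>M ?B)" by simp_all
    show "(\<lambda>zw. (snd (snd zw i) - \<delta>1 m (fst zw) (fst (snd zw i)))\<^sup>2 -
        (snd (snd zw i) - \<delta>2 m (fst zw) (fst (snd zw i)))\<^sup>2) \<in> borel_measurable (?A \<Otimes>\<^sub>M ?B)"
      by measurable
  qed
  have H: "H \<in> sets (?A \<Otimes>\<^sub>M ?B)"
    unfolding H_def using Tm by measurable
  have G: "G \<in> sets ?A"
    unfolding G_def comparable_fits_def Let_def not_less[symmetric] by measurable
  have Z1: "sample {1..m} \<omega> \<in> space ?A" and Z2: "sample {Suc m..n} \<omega> \<in> space ?B" if "\<omega> \<in> space M" for \<omega>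
    using measurable_space[OF sample_measurable that] by auto
  have Tw: "T z (sample {Suc m..n} \<omega>) =
      (\<Sum>i\<in>{Suc m..n}. (Y i \<omega> - \<delta>1 m z (X i \<omega>))\<^sup>2 - (Y i \<omega> - \<delta>2 m z (X i \<omega>))\<^sup>2)" for z \<omega>
    unfolding T_def by (intro sum.cong) auto
  let ?\<beta> = "(4 * C ^ 4 + 32 * \<sigma>2 / s\<^sup>2) / (real (n - m) * (1 - 1 / (1 + c)\<^sup>2)\<^sup>2)"
  have "prob {\<omega> \<in> space M. (z, sample {Suc m..n} \<omega>) \<in> H} \<le> ?\<beta>" if z: "z \<in> G" for z
  proof -
    have zA: "z \<in> space ?A" and good: "comparable_fits c s C (\<delta>1 m z) (\<delta>2 m z)"
      using z unfolding G_def by auto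
    have "{\<omega> \<in> space M. (z, sample {Suc m..n} \<omega>) \<in> H} = {\<omega> \<in> space M.
        (\<Sum>i\<in>{Suc m..n}. (Y i \<omega> - \<delta>1 m z (X i \<omega>))\<^sup>2 - (Y i \<omega> - \<delta>2 m z (X i \<omega>))\<^sup>2) \<ge> 0}"
      using zA Z2 by (auto simp: H_def space_pair_measure Tw)
    then show ?thesis
      using comparable_holdout_error_prob_le[OF _ _ _ \<sigma>2 var procedure_section_measurable[OF proc(1) mn(1) zA]
          procedure_section_measurable[OF proc(2) mn(1) zA] good c s C, of "{Suc m..n}"] mn
      by simp
  qed
  from indep_var_event_prob_le[OF ind H G this]
  have "prob {\<omega> \<in> space M. (sample {1..m} \<omega>, sample {Suc m..n} \<omega>) \<in> H}
      \<le> prob {\<omega> \<in> space M. sample {1..m} \<omega> \<notin> G} + ?\<beta>"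
    using C \<sigma>2 by simp
  moreover have "{\<omega> \<in> space M. (sample {1..m} \<omega>, sample {Suc m..n} \<omega>) \<in> H}
      = {\<omega> \<in> space M. CV_criterion X Y \<delta>2 m n \<omega> \<le> CV_criterion X Y \<delta>1 m n \<omega>}"
    using Z1 Z2
    by (auto simp: H_def space_pair_measure Tw CV_criterion_def estimator_def sum_subtractf)
  moreover have "{\<omega> \<in> space M. sample {1..m} \<omega> \<notin> G}
      = {\<omega> \<in> space M. \<not> comparable_fits c s C (estimator X Y \<delta>1 m \<omega>) (estimator X Y \<delta>2 m \<omega>)}"
    using Z1 by (auto simp: G_def estimator_def)
  ultimately show ?thesis by simp
qed

end

section \<open>Consistency\<close>

context regression_model
begin

text \<open>Constants in the stochastic bounds depend on the tolerance, so each
  \<open>\<eta>\<close> is treated on its own: outside an event of small probability the fits are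
  comparable with fixed constants, and the deterministic remainder vanishes.\<close>

lemma CV_error_prob_tendsto_0:
  fixes \<delta>1 \<delta>2 :: "'d procedure"
  defines "L k \<delta> \<equiv> Lq_loss k P f X Y \<delta>"
  assumes proc: "regression_procedure S \<delta>1" "regression_procedure S \<delta>2"
    and \<sigma>2: "\<sigma>2 \<ge> 0"
    and var: "\<And>i. i \<ge> 1 \<Longrightarrow>
      AE \<omega> in M. nn_cond_exp M (sigma_gen M S (X i)) (\<lambda>\<omega>. ennreal ((err i \<omega>)\<^sup>2)) \<omega> \<le> ennreal \<sigma>2"
    and rate1: "converges_exactly_at_rate M (L 2 \<delta>1) p"
    and rate2: "converges_exactly_at_rate M (L 2 \<delta>2) q"
    and better: "asymptotically_better M (L 2 \<delta>1) (L 2 \<delta>2)"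
    and ratio: "bounded_in_prob M (\<lambda>n \<omega>. L 4 \<delta>1 n \<omega> / L 2 \<delta>1 n \<omega>) B"
      "bounded_in_prob M (\<lambda>n \<omega>. L 4 \<delta>2 n \<omega> / L 2 \<delta>2 n \<omega>) B"
    and B: "B \<in> O(\<lambda>_. 1)"
    and split: "data_splitting n1 n2" "filterlim n1 at_top sequentially"
    and large: "filterlim (\<lambda>n. real (n2 n) * (max (p (n1 n)) (q (n1 n)))\<^sup>2) at_top sequentially"
  shows "(\<lambda>n. prob {\<omega> \<in> space M. CV_criterion X Y \<delta>2 (n1 n) n \<omega> \<le> CV_criterion X Y \<delta>1 (n1 n) n \<omega>})
    \<longlonglongrightarrow> 0"
proof -
  let ?bad = "\<lambda>n. prob {\<omega> \<in> space M. CV_criterion X Y \<delta>2 (n1 n) n \<omega> \<le> CV_criterion X Y \<delta>1 (n1 n) n \<omega>}"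
  let ?b = "\<lambda>m. max (p m) (q m)"
  have pq: "?b \<longlonglongrightarrow> 0" and pos: "p n > 0" "q n > 0" if "n \<ge> 1" for n
    using rate1 rate2 that tendsto_max[of p 0 sequentially q 0]
    unfolding converges_exactly_at_rate_def by auto
  have n1_pos: "\<forall>\<^sub>F n in sequentially. 1 \<le> n1 n"
    using split(2) unfolding filterlim_at_top by blast
  \<comment> \<open>The rates tend to 0, so eventually \<open>n2\<close> dominates \<open>n2\<close>
    times the squared rate, which diverges by assumption.\<close>
  have n2_large: "filterlim (\<lambda>n. real (n2 n)) at_top sequentially"
  proof (rule filterlim_at_top_mono[OF large])
    have "\<forall>\<^sub>F m in sequentially. ?b m < 1"
      using order_tendstoD(2)[OF pq[OF order_refl], of 1] by simp
    then have "\<forall>\<^sub>F n in sequentially. ?b (n1 n) < 1"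
      using split(2) by (rule eventually_compose_filterlim)
    with n1_pos show "\<forall>\<^sub>F n in sequentially. real (n2 n) * (?b (n1 n))\<^sup>2 \<le> real (n2 n)"
    proof eventually_elim
      case (elim n)
      then have "?b (n1 n) > 0" using pos[of "n1 n"] by auto
      then show ?case using elim by (intro mult_left_le power_le_one) auto
    qed
  qed
  have "\<forall>\<^sub>F n in sequentially. ?bad n < \<eta>" if \<eta>: "\<eta> > 0" for \<eta>
  proof -
    \<comment> \<open>Six exceptional events and the remainder cost less than
      \<open>7 * \<epsilon>\<close> in total; the cap 1/2 keeps \<open>\<epsilon>\<close> below 1,
      as the lower bounds in the definitions demand.\<close>
    define \<epsilon> where "\<epsilon> = min (\<eta> / 8) (1 / 2)"
    have \<epsilon>: "0 < \<epsilon>" "\<epsilon> < 1" "8 * \<epsilon> \<le> \<eta>" using \<eta> by (auto simp: \<epsilon>_def)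
    \<comment> \<open>The upper half of the exact rate makes the worse loss finite outside a small
      event.\<close>
    obtain C0 where "C0 > 0" and fin: "\<forall>\<^sub>F m in sequentially. prob {\<omega> \<in> space M. L 2 \<delta>2 m \<omega> > ennreal (C0 * q m)} < \<epsilon>"
      using rate2 \<epsilon> unfolding converges_exactly_at_rate_def bounded_in_prob_def by blast
    obtain c1 where c1: "c1 > 0" and lower1: "\<forall>\<^sub>F m in sequentially. prob {\<omega> \<in> space M. L 2 \<delta>1 m \<omega> \<ge> ennreal (c1 * p m)} \<ge> 1 - \<epsilon>"
      using rate1 \<epsilon> unfolding converges_exactly_at_rate_def by blast
    obtain c2 where c2: "c2 > 0" and lower2: "\<forall>\<^sub>F m in sequentially. prob {\<omega> \<in> space M. L 2 \<delta>2 m \<omega> \<ge> ennreal (c2 * q m)} \<ge> 1 - \<epsilon>"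
      using rate2 \<epsilon> unfolding converges_exactly_at_rate_def by blast
    obtain c where c: "c > 0" and bet: "\<forall>\<^sub>F m in sequentially. prob {\<omega> \<in> space M. L 2 \<delta>2 m \<omega> \<ge> ennreal (1 + c) * L 2 \<delta>1 m \<omega>} \<ge> 1 - \<epsilon>"
      using better \<epsilon> unfolding asymptotically_better_def by blast
    obtain C1 where C1: "C1 > 0" and ratio1: "\<forall>\<^sub>F m in sequentially. prob {\<omega> \<in> space M. L 4 \<delta>1 m \<omega> / L 2 \<delta>1 m \<omega> > ennreal (C1 * B m)} < \<epsilon>"
      using ratio(1) \<epsilon> unfolding bounded_in_prob_def by blast
    obtain C2 where C2: "C2 > 0" and ratio2: "\<forall>\<^sub>F m in sequentially. prob {\<omega> \<in> space M. L 4 \<delta>2 m \<omega> / L 2 \<delta>2 m \<omega> > ennreal (C2 * B m)} < \<epsilon>"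
      using ratio(2) \<epsilon> unfolding bounded_in_prob_def by blast
    obtain K where K: "K > 0" and BK: "\<forall>\<^sub>F m in sequentially. \<bar>B m\<bar> \<le> K"
      using landau_o.bigE[OF B] by auto
    \<comment> \<open>\<open>C\<close> serves both ratios and absorbs the eventual bound on
      \<open>B\<close>. With the minimum \<open>c'\<close>, the product
      \<open>c' * max (p m) (q m)\<close> is below \<open>c1 * p m\<close> or
      \<open>c2 * q m\<close>, according to which rate is larger.\<close>
    define C where "C = max C1 C2 * K"
    define c' where "c' = min c1 c2"
    have C: "C \<ge> 0" using C1 K unfolding C_def by (intro mult_nonneg_nonneg) auto
    have c': "c' > 0" using c1 c2 by (simp add: c'_def)
    let ?good = "\<lambda>m \<omega>. comparable_fits c (c' * ?b m) C (estimator X Y \<delta>1 m \<omega>) (estimator X Y \<delta>2 m \<omega>)"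
    have good: "\<forall>\<^sub>F m in sequentially. prob {\<omega> \<in> space M. \<not> ?good m \<omega>} \<le> 6 * \<epsilon>"
      using fin lower1 lower2 bet ratio1 ratio2 BK eventually_ge_at_top[of 1]
    proof eventually_elim
      case (elim m)
      have [measurable]: "L k \<delta>1 m \<in> borel_measurable M" "L k \<delta>2 m \<in> borel_measurable M" for k
        unfolding L_def using Lq_loss_measurable proc elim by blast+
      let ?Q1 = "\<lambda>\<omega>. L 2 \<delta>2 m \<omega> \<le> ennreal (C0 * q m)"
      let ?Q2 = "\<lambda>\<omega>. ennreal (c1 * p m) \<le> L 2 \<delta>1 m \<omega>"
      let ?Q3 = "\<lambda>\<omega>. ennreal (c2 * q m) \<le> L 2 \<delta>2 m \<omega>"
      let ?Q4 = "\<lambda>\<omega>. ennreal (1 + c) * L 2 \<delta>1 m \<omega> \<le> L 2 \<delta>2 m \<omega>"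
      let ?Q5 = "\<lambda>\<omega>. L 4 \<delta>1 m \<omega> / L 2 \<delta>1 m \<omega> \<le> ennreal (C1 * B m)"
      let ?Q6 = "\<lambda>\<omega>. L 4 \<delta>2 m \<omega> / L 2 \<delta>2 m \<omega> \<le> ennreal (C2 * B m)"
      have ev: "{\<omega> \<in> space M. ?Q1 \<omega>} \<in> events" "{\<omega> \<in> space M. ?Q2 \<omega>} \<in> events" "{\<omega> \<in> space M. ?Q3 \<omega>} \<in> events"
        "{\<omega> \<in> space M. ?Q4 \<omega>} \<in> events" "{\<omega> \<in> space M. ?Q5 \<omega>} \<in> events" "{\<omega> \<in> space M. ?Q6 \<omega>} \<in> events"
        by measurable
      have Q: "prob {\<omega> \<in> space M. \<not> ?Q1 \<omega>} \<le> \<epsilon>" "prob {\<omega> \<in> space M. \<not> ?Q2 \<omega>} \<le> \<epsilon>" "prob {\<omega> \<in> space M. \<not> ?Q3 \<omega>} \<le> \<epsilon>"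
        "prob {\<omega> \<in> space M. \<not> ?Q4 \<omega>} \<le> \<epsilon>" "prob {\<omega> \<in> space M. \<not> ?Q5 \<omega>} \<le> \<epsilon>" "prob {\<omega> \<in> space M. \<not> ?Q6 \<omega>} \<le> \<epsilon>"
        using elim prob_neg[OF ev(2)] prob_neg[OF ev(3)] prob_neg[OF ev(4)]
        by (simp_all add: not_le)
      have "?good m \<omega>" if q: "?Q1 \<omega>" "?Q2 \<omega>" "?Q3 \<omega>" "?Q4 \<omega>" "?Q5 \<omega>" "?Q6 \<omega>" for \<omega>
      proof -
        have B: "B m \<le> K" using elim by auto
        have "C1 * B m \<le> C" "C2 * B m \<le> C"
          unfolding C_def using B K C1 C2 by (smt (verit) mult_mono mult_left_mono mult_right_mono)+
        then have r: "L 4 \<delta>1 m \<omega> / L 2 \<delta>1 m \<omega> \<le> ennreal C" "L 4 \<delta>2 m \<omega> / L 2 \<delta>2 m \<omega> \<le> ennreal C"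
          using q by (auto intro: order_trans ennreal_leI)
        \<comment> \<open>The worse loss dominates the better one and so inherits its lower bound of
          order \<open>p m\<close>. Up to a constant it is therefore above the maximum of both
          rates.\<close>
        have "L 2 \<delta>1 m \<omega> \<le> ennreal (1 + c) * L 2 \<delta>1 m \<omega>"
          using mult_right_mono[of 1 "ennreal (1 + c)" "L 2 \<delta>1 m \<omega>"] c by simp
        then have "ennreal (c1 * p m) \<le> L 2 \<delta>2 m \<omega>" using q(2,4) by (meson order_trans)
        moreover have "c' * ?b m \<le> c1 * p m \<or> c' * ?b m \<le> c2 * q m"
          using pos[of m] elim by (auto simp: c'_def max_def intro!: mult_right_mono)
        ultimately have s: "ennreal (c' * ?b m) \<le> L 2 \<delta>2 m \<omega>"
          using q(3) by (meson ennreal_leI order_trans)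
        \<comment> \<open>The strictly positive rate keeps the better loss away from 0, so its ratio
          of norms is meaningful.\<close>
        have "0 < ennreal (c1 * p m)" using c1 pos[of m] elim by simp
        then have "0 < L 2 \<delta>1 m \<omega>" using q(2) by (meson less_le_trans)
        moreover have "L 2 \<delta>2 m \<omega> < \<infinity>" using q(1) by (auto intro: le_less_trans)
        ultimately show ?thesis
          using r s q(4) unfolding comparable_fits_def Let_def L_def Lq_loss_def by blast
      qed
      then have "prob {\<omega> \<in> space M. \<not> ?good m \<omega>}
          \<le> prob {\<omega> \<in> space M. \<not> (?Q1 \<omega> \<and> ?Q2 \<omega> \<and> ?Q3 \<omega> \<and> ?Q4 \<omega> \<and> ?Q5 \<omega> \<and> ?Q6 \<omega>)}"
        by (intro finite_measure_mono) (auto simp: not_less[symmetric])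
      also have "\<dots> \<le> \<epsilon> + (\<epsilon> + (\<epsilon> + (\<epsilon> + (\<epsilon> + \<epsilon>))))"
        by (intro prob_not_conj_le sets.sets_Collect_conj Q ev)
      finally show ?case by simp
    qed
    define \<kappa> where "\<kappa> = (1 - 1 / (1 + c)\<^sup>2)\<^sup>2"
    have "1 < (1 + c)\<^sup>2" using c by (intro one_less_power) auto
    then have \<kappa>: "\<kappa> > 0" by (simp add: \<kappa>_def)
    define rem where "rem n = (4 * C ^ 4 + 32 * \<sigma>2 / (c' * ?b (n1 n))\<^sup>2) / (real (n2 n) * \<kappa>)" for n
    \<comment> \<open>The two summands have the denominators \<open>n2\<close> and \<open>n2\<close>
      times the squared rate, and both diverge.\<close>
    have rem_eq: "rem n = 4 * C ^ 4 / \<kappa> / real (n2 n) + 32 * \<sigma>2 / (c'\<^sup>2 * \<kappa>) / (real (n2 n) * (?b (n1 n))\<^sup>2)" for n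
      by (simp add: rem_def add_divide_distrib power_mult_distrib mult_ac)
    have "rem \<longlonglongrightarrow> 0 + 0"
      unfolding rem_eq[abs_def] using n2_large large
      by (intro tendsto_add tendsto_divide_0[OF tendsto_const] filterlim_at_top_imp_at_infinity)
    then have rem: "\<forall>\<^sub>F n in sequentially. rem n < \<epsilon>"
      using \<epsilon> order_tendstoD(2) by fastforce
    have "\<forall>\<^sub>F n in sequentially. prob {\<omega> \<in> space M. \<not> ?good (n1 n) \<omega>} \<le> 6 * \<epsilon>"
      using good split(2) by (rule eventually_compose_filterlim)
    then show ?thesis
      using rem split(1)[unfolded data_splitting_def] n1_pos
    proof eventually_elim
      case (elim n)
      have m: "1 \<le> n1 n" "n1 n < n" "n - n1 n = n2 n" using elim by auto
      have "c' * ?b (n1 n) > 0" using c' pos[OF m(1)] by auto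
      then have "?bad n \<le> prob {\<omega> \<in> space M. \<not> ?good (n1 n) \<omega>} + rem n"
        using CV_error_prob_le[OF proc m(1,2) \<sigma>2 var c _ C] unfolding rem_def \<kappa>_def m(3) by blast
      then show ?case using elim \<epsilon> by linarith
    qed
  qed
  moreover have "\<forall>\<^sub>F n in sequentially. a < ?bad n" if "a < 0" for a
    by (intro always_eventually allI less_le_trans[OF that measure_nonneg])
  ultimately show ?thesis by (rule order_tendstoI[rotated])
qed

text \<open>The previous limit is applied with the better procedure in first place, whichever index
  it bears. A wrong choice gives a strict inequality of criteria if index 1 is better and a
  nonstrict one if index 2 is; the nonstrict event covers both.\<close>

lemma CV_consistentI:
  fixes \<delta>1 \<delta>2 :: "'d procedure"
  defines "L k \<delta> \<equiv> Lq_loss k P f X Y \<delta>"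
  assumes proc: "regression_procedure S \<delta>1" "regression_procedure S \<delta>2"
    and \<sigma>2: "\<sigma>2 \<ge> 0"
    and var: "\<And>i. i \<ge> 1 \<Longrightarrow>
      AE \<omega> in M. nn_cond_exp M (sigma_gen M S (X i)) (\<lambda>\<omega>. ennreal ((err i \<omega>)\<^sup>2)) \<omega> \<le> ennreal \<sigma>2"
    and rate1: "converges_exactly_at_rate M (L 2 \<delta>1) p"
    and rate2: "converges_exactly_at_rate M (L 2 \<delta>2) q"
    and better: "asymptotically_better M (L 2 \<delta>1) (L 2 \<delta>2) \<or> asymptotically_better M (L 2 \<delta>2) (L 2 \<delta>1)"
    and ratio: "bounded_in_prob M (\<lambda>n \<omega>. L 4 \<delta>1 n \<omega> / L 2 \<delta>1 n \<omega>) B"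
      "bounded_in_prob M (\<lambda>n \<omega>. L 4 \<delta>2 n \<omega> / L 2 \<delta>2 n \<omega>) B"
    and B: "B \<in> O(\<lambda>_. 1)"
    and split: "data_splitting n1 n2" "filterlim n1 at_top sequentially"
    and large: "filterlim (\<lambda>n. real (n2 n) * (max (p (n1 n)) (q (n1 n)))\<^sup>2) at_top sequentially"
  shows "CV_consistent M P f X Y \<delta>1 \<delta>2 n1"
proof -
  let ?wrong = "\<lambda>n. {\<omega> \<in> space M. CV_choice X Y \<delta>1 \<delta>2 (n1 n) n \<omega> \<noteq> better_index M (L 2 \<delta>1) (L 2 \<delta>2)}"
  \<comment> \<open>Monotonicity of \<open>measure\<close> asks for measurability of the larger
    event, hence the criteria have to be random variables.\<close>
  have CV[measurable]: "CV_criterion X Y \<delta> (n1 n) n \<in> borel_measurable M"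
    if "1 \<le> n1 n" "\<delta> \<in> {\<delta>1, \<delta>2}" for n \<delta>
  proof -
    have "regression_procedure S \<delta>" using proc that by auto
    then have d: "case_prod (\<delta> (n1 n)) \<in> borel_measurable (sample_space {1..n1 n} \<Otimes>\<^sub>M restrict_space borel S)"
      using that unfolding regression_procedure_def by auto
    have Xm[measurable]: "X i \<in> M \<rightarrow>\<^sub>M restrict_space borel S" if "i \<ge> 1" for i using X_measurable that by auto
    have Ym: "Y i \<in> borel_measurable M" if "i \<ge> 1" for i
    proof -
      have "(\<lambda>\<omega>. (X i \<omega>, Y i \<omega>)) \<in> M \<rightarrow>\<^sub>M restrict_space borel S \<Otimes>\<^sub>M borel"
        using indep that by (auto simp: indep_vars_def)
      from measurable_compose[OF this measurable_snd] show ?thesis by simp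
    qed
    show ?thesis
      unfolding CV_criterion_def estimator_def
    proof (intro borel_measurable_sum)
      fix i assume "i \<in> {n1 n + 1..n}"
      then have i: "i \<ge> 1" by auto
      have "(\<lambda>\<omega>. (sample {1..n1 n} \<omega>, X i \<omega>)) \<in> M \<rightarrow>\<^sub>M sample_space {1..n1 n} \<Otimes>\<^sub>M restrict_space borel S"
        using Xm[OF i] by (intro measurable_Pair sample_measurable) auto
      from measurable_compose[OF this d]
      have "(\<lambda>\<omega>. \<delta> (n1 n) (sample {1..n1 n} \<omega>) (X i \<omega>)) \<in> borel_measurable M" by simp
      then show "(\<lambda>\<omega>. (Y i \<omega> - \<delta> (n1 n) (sample {1..n1 n} \<omega>) (X i \<omega>))\<^sup>2) \<in> borel_measurable M"
        using Ym[OF i] by measurable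
    qed
  qed
  have n1_pos: "\<forall>\<^sub>F n in sequentially. 1 \<le> n1 n"
    using split(2) unfolding filterlim_at_top by blast
  have large': "filterlim (\<lambda>n. real (n2 n) * (max (q (n1 n)) (p (n1 n)))\<^sup>2) at_top sequentially"
    using large by (simp add: max.commute)
  \<comment> \<open>In both uses \<open>\<delta>a\<close> is the better procedure and
    \<open>\<delta>b\<close> the other one, so the two orders share one sandwich argument.\<close>
  have squeeze: "(\<lambda>n. prob (?wrong n)) \<longlonglongrightarrow> 0"
    if lim: "(\<lambda>n. prob {\<omega> \<in> space M. CV_criterion X Y \<delta>b (n1 n) n \<omega> \<le> CV_criterion X Y \<delta>a (n1 n) n \<omega>}) \<longlonglongrightarrow> 0"
      and ab: "\<delta>a \<in> {\<delta>1, \<delta>2}" "\<delta>b \<in> {\<delta>1, \<delta>2}"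
      and sub: "\<And>n. ?wrong n \<subseteq> {\<omega> \<in> space M. CV_criterion X Y \<delta>b (n1 n) n \<omega> \<le> CV_criterion X Y \<delta>a (n1 n) n \<omega>}"
    for \<delta>a \<delta>b
  proof (rule tendsto_sandwich[OF _ _ tendsto_const lim])
    show "\<forall>\<^sub>F n in sequentially. prob (?wrong n) \<le>
        prob {\<omega> \<in> space M. CV_criterion X Y \<delta>b (n1 n) n \<omega> \<le> CV_criterion X Y \<delta>a (n1 n) n \<omega>}"
      using n1_pos
    proof eventually_elim
      case (elim n)
      show ?case
        using CV[OF elim ab(1)] CV[OF elim ab(2)] by (intro finite_measure_mono sub borel_measurable_le)
    qed
  qed simp
  have "(\<lambda>n. prob (?wrong n)) \<longlonglongrightarrow> 0"
  \<comment> \<open>The split follows the order of the tests in \<open>better_index\<close>: once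
    the first test fails, \<open>better\<close> forces the index 2 and excludes the undefined
    branch.\<close>
  proof (cases "asymptotically_better M (L 2 \<delta>1) (L 2 \<delta>2)")
    case True
    have "(\<lambda>n. prob {\<omega> \<in> space M. CV_criterion X Y \<delta>2 (n1 n) n \<omega> \<le> CV_criterion X Y \<delta>1 (n1 n) n \<omega>}) \<longlonglongrightarrow> 0"
      using True rate1 rate2 ratio unfolding L_def
      by (intro CV_error_prob_tendsto_0[OF proc \<sigma>2 var _ _ _ _ _ B split large])
    then show ?thesis
      by (rule squeeze) (use True in \<open>auto simp: better_index_def CV_choice_def\<close>)
  next
    case False
    then have better2: "asymptotically_better M (L 2 \<delta>2) (L 2 \<delta>1)" using better by blast
    have "(\<lambda>n. prob {\<omega> \<in> space M. CV_criterion X Y \<delta>1 (n1 n) n \<omega> \<le> CV_criterion X Y \<delta>2 (n1 n) n \<omega>}) \<longlonglongrightarrow> 0"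
      using better2 rate1 rate2 ratio unfolding L_def
      by (intro CV_error_prob_tendsto_0[OF proc(2,1) \<sigma>2 var _ _ _ _ _ B split large'])
    then show ?thesis
      by (rule squeeze) (use False better2 in \<open>auto simp: better_index_def CV_choice_def split: if_splits\<close>)
  qed
  then show ?thesis unfolding CV_consistent_def L_def .
qed

end

section \<open>The two splitting schemes\<close>

theorem corollary1:
  fixes M :: "'w measure"
    and S :: "(real ^ 'd) set"
    and P :: "(real ^ 'd) measure"
    and f :: "real ^ 'd \<Rightarrow> real"
    and X :: "nat \<Rightarrow> 'w \<Rightarrow> real ^ 'd"
    and Y err :: "nat \<Rightarrow> 'w \<Rightarrow> real"
    and \<delta>1 \<delta>2 :: "'d procedure"
    and p q A B :: "nat \<Rightarrow> real"
    and \<sigma>2 :: real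
  assumes setting: "regression_model M S P f X Y err"
    and procedures: "regression_procedure S \<delta>1" "regression_procedure S \<delta>2"
    and rate1: "converges_exactly_at_rate M (Lq_loss 2 P f X Y \<delta>1) p"
    and rate2: "converges_exactly_at_rate M (Lq_loss 2 P f X Y \<delta>2) q"
    and cond0: "\<sigma>2 > 0"
      "\<And>i. i \<ge> 1 \<Longrightarrow> AE \<omega> in M.
         nn_cond_exp M (sigma_gen M S (X i)) (\<lambda>\<omega>. ennreal ((err i \<omega>)\<^sup>2)) \<omega> \<le> ennreal \<sigma>2"
    and cond1: "\<And>n. n \<ge> 1 \<Longrightarrow> A n > 0"
      "\<And>\<delta>. \<delta> \<in> {\<delta>1, \<delta>2} \<Longrightarrow> bounded_in_prob M (Linf_loss P f X Y \<delta>) A"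
    and cond2: "asymptotically_better M (Lq_loss 2 P f X Y \<delta>1) (Lq_loss 2 P f X Y \<delta>2) \<or>
      asymptotically_better M (Lq_loss 2 P f X Y \<delta>2) (Lq_loss 2 P f X Y \<delta>1)"
    and cond3: "\<And>n. n \<ge> 1 \<Longrightarrow> B n > 0"
      "\<And>\<delta>. \<delta> \<in> {\<delta>1, \<delta>2} \<Longrightarrow>
         bounded_in_prob M (\<lambda>n \<omega>. Lq_loss 4 P f X Y \<delta> n \<omega> / Lq_loss 2 P f X Y \<delta> n \<omega>) B"
    and bounded: "B \<in> O(\<lambda>_. 1)" "A \<in> O(\<lambda>_. 1)"
  shows
    "((\<lambda>n. max (p n) (q n)) \<in> \<Theta>(\<lambda>n. real n powr (- 1 / 2)) \<longrightarrow>
        (\<forall>n1 n2. data_splitting n1 n2 \<and> filterlim n1 at_top sequentially \<and>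
           filterlim (\<lambda>n. real (n2 n) / real (n1 n)) at_top sequentially \<longrightarrow>
           CV_consistent M P f X Y \<delta>1 \<delta>2 n1)) \<and>
     (filterlim (\<lambda>n. max (p n) (q n) * real n powr (1 / 2)) at_top sequentially \<longrightarrow>
        (\<forall>n1 n2. data_splitting n1 n2 \<and> filterlim n1 at_top sequentially \<and>
           (\<lambda>n. real (n1 n) / real (n2 n)) \<in> O(\<lambda>_. 1) \<longrightarrow>
           CV_consistent M P f X Y \<delta>1 \<delta>2 n1))"
proof -
  interpret regression_model M S P f X Y err by (rule setting)
  let ?b = "\<lambda>n. max (p n) (q n)"
  have pos: "?b n > 0" if "n \<ge> 1" for n
    using rate1 that unfolding converges_exactly_at_rate_def by (simp add: less_max_iff_disj)
  have consistent: "CV_consistent M P f X Y \<delta>1 \<delta>2 n1"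
    if "data_splitting n1 n2" "filterlim n1 at_top sequentially"
      "filterlim (\<lambda>n. real (n2 n) * (?b (n1 n))\<^sup>2) at_top sequentially" for n1 n2
    by (rule CV_consistentI[OF procedures less_imp_le[OF cond0(1)] cond0(2) rate1 rate2 cond2
          _ _ bounded(1) that]) (use cond3(2) in auto)
  show ?thesis
  proof (intro conjI impI allI; elim conjE)
    fix n1 n2
    assume rate: "?b \<in> \<Theta>(\<lambda>n. real n powr (- 1 / 2))"
      and split: "data_splitting n1 n2" and n1: "filterlim n1 at_top sequentially"
      and quot: "filterlim (\<lambda>n. real (n2 n) / real (n1 n)) at_top sequentially"
    \<comment> \<open>The lower half of the \<open>\<Theta>\<close> bound, taken at sample size
      \<open>n1\<close>, makes the squared rate at least \<open>c\<^sup>2 / n1\<close>. Multiplying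
      by \<open>n2\<close> leaves a constant times the diverging quotient
      \<open>n2 / n1\<close>.\<close>
    obtain c where c: "c > 0" and "\<forall>\<^sub>F n in sequentially. norm (?b n) \<ge> c * norm (real n powr (- 1 / 2))"
      by (rule landau_omega.bigE[OF bigthetaD2[OF rate]])
    from eventually_compose_filterlim[OF this(2) n1]
    have "\<forall>\<^sub>F n in sequentially. norm (?b (n1 n)) \<ge> c * norm (real (n1 n) powr (- 1 / 2))" .
    moreover have "\<forall>\<^sub>F n in sequentially. 1 \<le> n1 n"
      using n1 unfolding filterlim_at_top by blast
    ultimately have "\<forall>\<^sub>F n in sequentially. c\<^sup>2 * (real (n2 n) / real (n1 n)) \<le> real (n2 n) * (?b (n1 n))\<^sup>2"
    proof eventually_elim
      case (elim n)
      then have "c * real (n1 n) powr (- 1 / 2) \<le> ?b (n1 n)" using pos[of "n1 n"] by simp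
      from power_mono[OF this, of 2] c
      have "c\<^sup>2 * (real (n1 n) powr (- 1 / 2))\<^sup>2 \<le> (?b (n1 n))\<^sup>2"
        by (simp add: power_mult_distrib)
      moreover have "(real (n1 n) powr (- 1 / 2))\<^sup>2 = 1 / real (n1 n)"
        using elim by (simp add: power2_eq_square powr_neg_one flip: powr_add)
      ultimately have "c\<^sup>2 * (1 / real (n1 n)) \<le> (?b (n1 n))\<^sup>2" by simp
      from mult_left_mono[OF this, of "real (n2 n)"] show ?case by (simp add: mult_ac)
    qed
    moreover have "filterlim (\<lambda>n. c\<^sup>2 * (real (n2 n) / real (n1 n))) at_top sequentially"
      using c by (intro filterlim_tendsto_pos_mult_at_top[OF tendsto_const _ quot]) auto
    ultimately have "filterlim (\<lambda>n. real (n2 n) * (?b (n1 n))\<^sup>2) at_top sequentially"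
      by (rule filterlim_at_top_mono[rotated])
    then show "CV_consistent M P f X Y \<delta>1 \<delta>2 n1" by (rule consistent[OF split n1])
  next
    fix n1 n2
    assume rate: "filterlim (\<lambda>n. ?b n * real n powr (1 / 2)) at_top sequentially"
      and split: "data_splitting n1 n2" and n1: "filterlim n1 at_top sequentially"
      and quot: "(\<lambda>n. real (n1 n) / real (n2 n)) \<in> O(\<lambda>_. 1)"
    obtain c where c: "c > 0" and quot_le: "\<forall>\<^sub>F n in sequentially. real (n1 n) / real (n2 n) \<le> c"
      using landau_o.bigE[OF quot] by auto
    have lim: "filterlim (\<lambda>n. ?b (n1 n) * real (n1 n) powr (1 / 2)) at_top sequentially"
      using filterlim_compose[OF rate n1] .
    \<comment> \<open>As \<open>n2\<close> is positive, the quotient bound reads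
      \<open>n1 \<le> c * n2\<close>. Trading \<open>n2\<close> for \<open>n1 / c\<close> produces
      the square of the rate times the root of \<open>n1\<close>, which diverges by
      assumption.\<close>
    have "\<forall>\<^sub>F n in sequentially. 1 / c * (?b (n1 n) * real (n1 n) powr (1 / 2))\<^sup>2 \<le> real (n2 n) * (?b (n1 n))\<^sup>2"
      using quot_le split[unfolded data_splitting_def]
    proof eventually_elim
      case (elim n)
      have "(real (n1 n) powr (1 / 2))\<^sup>2 = real (n1 n)"
        using elim by (simp add: power2_eq_square flip: powr_add)
      moreover have "real (n1 n) / c \<le> real (n2 n)"
        using elim c by (simp add: field_simps)
      from mult_right_mono[OF this, of "(?b (n1 n))\<^sup>2"]
      have "real (n1 n) / c * (?b (n1 n))\<^sup>2 \<le> real (n2 n) * (?b (n1 n))\<^sup>2" by simp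
      ultimately show ?case by (simp add: power_mult_distrib mult_ac)
    qed
    moreover have "filterlim (\<lambda>n. 1 / c * (?b (n1 n) * real (n1 n) powr (1 / 2))\<^sup>2) at_top sequentially"
      using c by (intro filterlim_tendsto_pos_mult_at_top[OF tendsto_const] filterlim_pow_at_top lim) auto
    ultimately have "filterlim (\<lambda>n. real (n2 n) * (?b (n1 n))\<^sup>2) at_top sequentially"
      by (rule filterlim_at_top_mono[rotated])
    then show "CV_consistent M P f X Y \<delta>1 \<delta>2 n1" by (rule consistent[OF split n1])
  qed
qed

end
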